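(* Let $e\geqslant 2$ be an integer, $q=2^e$ and $G=G_2(q)$. Let $a,b$ be simple roots for $G$ with $a$ short and $b$ long, and let $$H=\langle X_{3a+2b},X_{-(3a+2b)},X_a,X_{-a}\rangle\leqslant G,$$ so that $H\cong \mathrm{L}_2(q)\times\mathrm{L}_2(q)$. If $g=x_b(1)x_{a+b}(1)x_{-b}(1)\in G$, then $H\cap H^g=1$ and thus $b(G,H)=2$.
   Context: For each root $r$ of the root system of type $G_2$, $X_r=\{x_r(t) : t\in\mathbb{F}_q\}$ denotes the corresponding root subgroup of the Chevalley group $G_2(q)$, with $x_r(t)$ the usual root elements with respect to a Chevalley basis. Equivalently, if $\bar G=G_2(k)$ with $k$ an algebraically closed field of characteristic $2$ and $\sigma$ is a Frobenius morphism of $\bar G$ with $\bar G_\sigma=G_2(2)$ and $\bar G_{\sigma^e}=G$, then $H=\bar H_{\sigma^e}$, where $\bar H=A_1\tilde A_1$ is a $\sigma$-stable maximal rank subgroup, the second factor being generated by short root elements. Here $H^g=g^{-1}Hg$, and the base size $b(G,H)$ is the minimal size of a subset $S\subseteq G$ with $\bigcap_{s\in S}H^s=\bigcap_{s\in G}H^s$ (which equals $1$ here). *)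

theory Defs
  imports "HOL-Analysis.Analysis" "HOL-Algebra.Generated_Groups"
begin

section \<open>The root system of type \<open>G\<^sub>2\<close>\<close>

text \<open>The constructor \<open>Rij\<close> stands for the positive root \<open>i a + j b\<close>, where \<open>a\<close> is the short
  and \<open>b\<close> the long simple root.\<close>

datatype g2_pos = R10 | R01 | R11 | R21 | R31 | R32

datatype g2_root = Pos g2_pos | Neg g2_pos

primrec pos_coords :: "g2_pos \<Rightarrow> int \<times> int" where
  "pos_coords R10 = (1, 0)"
| "pos_coords R01 = (0, 1)"
| "pos_coords R11 = (1, 1)"
| "pos_coords R21 = (2, 1)"
| "pos_coords R31 = (3, 1)"
| "pos_coords R32 = (3, 2)"

primrec coords :: "g2_root \<Rightarrow> int \<times> int" where
  "coords (Pos p) = pos_coords p"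
| "coords (Neg p) = - pos_coords p"

text \<open>The Weyl-invariant form on the root lattice with \<open>(a,a) = 2\<close>, \<open>(a,b) = -3\<close>, \<open>(b,b) = 6\<close>.\<close>

definition g2_form :: "int \<times> int \<Rightarrow> int \<times> int \<Rightarrow> int" where
  "g2_form u v = 2 * fst u * fst v - 3 * (fst u * snd v + snd u * fst v) + 6 * snd u * snd v"

text \<open>\<open>cartan_int s r = 2 (s,r) / (r,r)\<close>, the value of the root \<open>s\<close> on the coroot \<open>h\<^sub>r\<close>; the
  division is exact.\<close>

definition cartan_int :: "g2_root \<Rightarrow> g2_root \<Rightarrow> int" where
  "cartan_int s r =
     2 * g2_form (coords s) (coords r) div g2_form (coords r) (coords r)"

text \<open>The largest \<open>p\<close> such that \<open>s - p r\<close> is a root.\<close>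

definition string_depth :: "g2_root \<Rightarrow> g2_root \<Rightarrow> nat" where
  "string_depth r s =
     (GREATEST p. \<exists>t. coords t = (fst (coords s) - int p * fst (coords r),
                              snd (coords s) - int p * snd (coords r)))"

section \<open>Chevalley bases\<close>

text \<open>\<open>E r\<close> is the root vector \<open>e\<^sub>r\<close>; \<open>Ha\<close> and \<open>Hb\<close> are the simple coroots \<open>h\<^sub>a\<close> and \<open>h\<^sub>b\<close>.\<close>

datatype g2_basis = E g2_root | Ha | Hb

lemma UNIV_g2_pos: "UNIV = {R10, R01, R11, R21, R31, R32}"
  by (auto intro: g2_pos.exhaust)

lemma UNIV_g2_root: "UNIV = range Pos \<union> range Neg"
  by (auto intro: g2_root.exhaust)

lemma UNIV_g2_basis: "UNIV = insert Ha (insert Hb (range E))"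
  by (auto intro: g2_basis.exhaust)

instance g2_pos :: finite
  by standard (simp add: UNIV_g2_pos)

instance g2_root :: finite
  by standard (simp add: UNIV_g2_root)

instance g2_basis :: finite
  by standard (simp add: UNIV_g2_basis)

text \<open>The coroot \<open>h\<^sub>r = 2 r / (r,r)\<close> as a combination of \<open>h\<^sub>a = 2 a / (a,a)\<close> and
  \<open>h\<^sub>b = 2 b / (b,b)\<close>; the divisions are exact.\<close>

definition coroot :: "g2_root \<Rightarrow> int ^ g2_basis" where
  "coroot r =
     (fst (coords r) * g2_form (1, 0) (1, 0) div g2_form (coords r) (coords r)) *s axis Ha 1 +
     (snd (coords r) * g2_form (0, 1) (0, 1) div g2_form (coords r) (coords r)) *s axis Hb 1"

text \<open>The multiplication table of the Lie algebra in terms of a family \<open>N\<close> of structure constants: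
  \<open>[e\<^sub>r, e\<^sub>s]\<close> is \<open>h\<^sub>r\<close> if \<open>r + s = 0\<close>, \<open>N r s e\<^bsub>r+s\<^esub>\<close> if \<open>r + s\<close> is a root, and \<open>0\<close> otherwise.\<close>

fun basis_bracket :: "(g2_root \<Rightarrow> g2_root \<Rightarrow> int) \<Rightarrow> g2_basis \<Rightarrow> g2_basis \<Rightarrow> int ^ g2_basis" where
  "basis_bracket N (E r) (E s) =
     (if coords r + coords s = 0 then coroot r
      else (\<Sum>t | coords t = coords r + coords s. N r s *s axis (E t) 1))"
| "basis_bracket N Ha (E s) = cartan_int s (Pos R10) *s axis (E s) 1"
| "basis_bracket N Hb (E s) = cartan_int s (Pos R01) *s axis (E s) 1"
| "basis_bracket N (E r) Ha = - cartan_int r (Pos R10) *s axis (E r) 1"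
| "basis_bracket N (E r) Hb = - cartan_int r (Pos R01) *s axis (E r) 1"
| "basis_bracket N _ _ = 0"

definition bracket ::
  "(g2_root \<Rightarrow> g2_root \<Rightarrow> int) \<Rightarrow> int ^ g2_basis \<Rightarrow> int ^ g2_basis \<Rightarrow> int ^ g2_basis" where
  "bracket N u v = (\<Sum>x\<in>UNIV. \<Sum>y\<in>UNIV. (u $ x * v $ y) *s basis_bracket N x y)"

text \<open>\<open>N\<close> is the family of structure constants of a Chevalley basis of the simple Lie algebra of
  type \<open>G\<^sub>2\<close> (only its values at pairs of roots whose sum is a root matter).  A Chevalley basis is
  determined only up to signs, so \<open>N\<close> is kept as a parameter.\<close>

definition chevalley_constants :: "(g2_root \<Rightarrow> g2_root \<Rightarrow> int) \<Rightarrow> bool" where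
  "chevalley_constants N \<longleftrightarrow>
     (\<forall>u. bracket N u u = 0) \<and>
     (\<forall>u v w. bracket N u (bracket N v w) + bracket N v (bracket N w u) +
              bracket N w (bracket N u v) = 0) \<and>
     (\<forall>r s t. coords t = coords r + coords s \<longrightarrow> \<bar>N r s\<bar> = int (string_depth r s) + 1)"

section \<open>The Chevalley group\<close>

definition ad_root :: "(g2_root \<Rightarrow> g2_root \<Rightarrow> int) \<Rightarrow> g2_root \<Rightarrow> int ^ g2_basis ^ g2_basis" where
  "ad_root N r = (\<chi> i j. bracket N (axis (E r) 1) (axis j 1) $ i)"

text \<open>The matrix of \<open>(ad e\<^sub>r)\<^sup>n / n!\<close>, which is integral for a Chevalley basis (so the division is
  exact).\<close>

definition ad_divided_power ::
  "(g2_root \<Rightarrow> g2_root \<Rightarrow> int) \<Rightarrow> g2_root \<Rightarrow> nat \<Rightarrow> int ^ g2_basis ^ g2_basis" where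
  "ad_divided_power N r n = (\<chi> i j. (((**) (ad_root N r) ^^ n) (mat 1)) $ i $ j div fact n)"

text \<open>\<open>x\<^sub>r(t) = exp (t ad e\<^sub>r)\<close>, with the integral coefficients of the exponential reduced into the
  field \<open>'k\<close>.  The series stops at \<open>n = 3\<close>, because root strings in \<open>G\<^sub>2\<close> have at most four members
  and hence \<open>(ad e\<^sub>r)\<^sup>4 = 0\<close>.\<close>

definition root_elt ::
  "(g2_root \<Rightarrow> g2_root \<Rightarrow> int) \<Rightarrow> g2_root \<Rightarrow> 'k::field \<Rightarrow> 'k ^ g2_basis ^ g2_basis" where
  "root_elt N r t = (\<chi> i j. \<Sum>n\<le>3. of_int (ad_divided_power N r n $ i $ j) * t ^ n)"

definition root_subgroup ::
  "(g2_root \<Rightarrow> g2_root \<Rightarrow> int) \<Rightarrow> g2_root \<Rightarrow> ('k::field ^ g2_basis ^ g2_basis) set" where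
  "root_subgroup N r = range (root_elt N r)"

definition GL :: "('k::field ^ 'n ^ 'n) monoid" where
  "GL = \<lparr>carrier = {A. invertible A}, mult = (**), one = mat 1\<rparr>"

definition G2 :: "(g2_root \<Rightarrow> g2_root \<Rightarrow> int) \<Rightarrow> ('k::field ^ g2_basis ^ g2_basis) monoid" where
  "G2 N = GL\<lparr>carrier := generate GL (\<Union>r. root_subgroup N r)\<rparr>"

section \<open>The groups \<open>L\<^sub>2(q)\<close>, conjugates and base size\<close>

definition SL :: "('k::field ^ 'n ^ 'n) monoid" where
  "SL = GL\<lparr>carrier := {A. det A = 1}\<rparr>"

definition PSL :: "('k::field ^ 'n ^ 'n) set monoid" where
  "PSL = SL Mod {A \<in> carrier SL. \<exists>c. A = mat c}"

abbreviation L2 :: "('k::field ^ 2 ^ 2) set monoid" where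
  "L2 \<equiv> PSL"

definition conjugate :: "('a, 'b) monoid_scheme \<Rightarrow> 'a set \<Rightarrow> 'a \<Rightarrow> 'a set" where
  "conjugate G H g = (\<lambda>h. inv\<^bsub>G\<^esub> g \<otimes>\<^bsub>G\<^esub> h \<otimes>\<^bsub>G\<^esub> g) ` H"

text \<open>The intersection is taken inside \<open>G\<close>, so that it is \<open>G\<close> when \<open>S\<close> is empty.\<close>

definition conj_inter :: "('a, 'b) monoid_scheme \<Rightarrow> 'a set \<Rightarrow> 'a set \<Rightarrow> 'a set" where
  "conj_inter G H S = carrier G \<inter> (\<Inter>s\<in>S. conjugate G H s)"

definition base_size :: "('a, 'b) monoid_scheme \<Rightarrow> 'a set \<Rightarrow> nat" where
  "base_size G H =
     (LEAST n. \<exists>S. S \<subseteq> carrier G \<and> finite S \<and> card S = n \<and>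
        conj_inter G H S = conj_inter G H (carrier G))"

section \<open>Existence of Chevalley structure constants\<close>

text \<open>One choice of structure constants, which satisfies \<open>N (- r) (- s) = - N r s\<close>; the table
  for pairs of opposite sign is that of \<open>N (Pos p) (Neg q)\<close>.\<close>

definition sample_pp :: "g2_pos \<Rightarrow> g2_pos \<Rightarrow> int" where
  "sample_pp p q = (case p of
       R10 \<Rightarrow> (case q of R01 \<Rightarrow> 1 | R11 \<Rightarrow> 2 | R21 \<Rightarrow> 3 | _ \<Rightarrow> 0)
     | R01 \<Rightarrow> (case q of R10 \<Rightarrow> -1 | R31 \<Rightarrow> 1 | _ \<Rightarrow> 0)
     | R11 \<Rightarrow> (case q of R10 \<Rightarrow> -2 | R21 \<Rightarrow> -3 | _ \<Rightarrow> 0)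
     | R21 \<Rightarrow> (case q of R10 \<Rightarrow> -3 | R11 \<Rightarrow> 3 | _ \<Rightarrow> 0)
     | R31 \<Rightarrow> (case q of R01 \<Rightarrow> -1 | _ \<Rightarrow> 0)
     | R32 \<Rightarrow> 0)"

definition sample_pn :: "g2_pos \<Rightarrow> g2_pos \<Rightarrow> int" where
  "sample_pn p q = (case p of
       R10 \<Rightarrow> (case q of R11 \<Rightarrow> -3 | R21 \<Rightarrow> -2 | R31 \<Rightarrow> -1 | _ \<Rightarrow> 0)
     | R01 \<Rightarrow> (case q of R11 \<Rightarrow> 1 | R32 \<Rightarrow> -1 | _ \<Rightarrow> 0)
     | R11 \<Rightarrow> (case q of R10 \<Rightarrow> -3 | R01 \<Rightarrow> 1 | R21 \<Rightarrow> 2 | R32 \<Rightarrow> 1 | _ \<Rightarrow> 0)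
     | R21 \<Rightarrow> (case q of R10 \<Rightarrow> -2 | R11 \<Rightarrow> 2 | R31 \<Rightarrow> 1 | R32 \<Rightarrow> -1 | _ \<Rightarrow> 0)
     | R31 \<Rightarrow> (case q of R10 \<Rightarrow> -1 | R21 \<Rightarrow> 1 | R32 \<Rightarrow> 1 | _ \<Rightarrow> 0)
     | R32 \<Rightarrow> (case q of R01 \<Rightarrow> -1 | R11 \<Rightarrow> 1 | R21 \<Rightarrow> -1 | R31 \<Rightarrow> 1 | _ \<Rightarrow> 0))"

fun sample :: "g2_root \<Rightarrow> g2_root \<Rightarrow> int" where
  "sample (Pos p) (Pos q) = sample_pp p q"
| "sample (Pos p) (Neg q) = sample_pn p q"
| "sample (Neg p) (Pos q) = - sample_pn p q"
| "sample (Neg p) (Neg q) = - sample_pp p q"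

lemma vec_axis_induct:
  fixes u :: "int ^ g2_basis"
  assumes "P 0" "\<And>u v. P u \<Longrightarrow> P v \<Longrightarrow> P (u + v)" "\<And>c x. P (c *s axis x 1)"
  shows "P u"
proof -
  have "P (\<Sum>x\<in>A. u $ x *s axis x 1)" if "finite A" for A
    using that by (induction A rule: finite_induct) (auto intro: assms)
  from this[of UNIV] show ?thesis
    by (simp add: basis_expansion)
qed

lemma bracket_add_left: "bracket N (u + u') v = bracket N u v + bracket N u' v"
  by (simp add: bracket_def distrib_right sum.distrib vector_sadd_rdistrib)

lemma bracket_add_right: "bracket N u (v + v') = bracket N u v + bracket N u v'"
  by (simp add: bracket_def distrib_left sum.distrib vector_sadd_rdistrib)

lemma bracket_scale_left: "bracket N (c *s u) v = c *s bracket N u v"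
  by (simp add: bracket_def vec_eq_iff sum_distrib_left mult.assoc)

lemma bracket_scale_right: "bracket N u (c *s v) = c *s bracket N u v"
  by (simp add: bracket_def vec_eq_iff sum_distrib_left mult.assoc mult.left_commute)

lemma bracket_zero_left: "bracket N 0 v = 0"
  by (simp add: bracket_def)

lemma bracket_zero_right: "bracket N u 0 = 0"
  by (simp add: bracket_def)

lemma bracket_axis: "bracket N (axis x 1) (axis y 1) = basis_bracket N x y"
proof -
  have "bracket N (axis x 1) (axis y 1) =
      (\<Sum>i\<in>UNIV. \<Sum>j\<in>UNIV. if i = x then if j = y then basis_bracket N i j else 0 else 0)"
    unfolding bracket_def by (intro sum.cong refl) (auto simp: axis_def vec_eq_iff)
  also have "\<dots> = (\<Sum>i\<in>UNIV. if i = x then basis_bracket N i y else 0)"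
    by (intro sum.cong refl) auto
  finally show ?thesis by simp
qed

text \<open>Vectors in the following computation are lists of pairs of a coefficient and a basis
  element.\<close>

definition all_roots :: "g2_root list" where
  "all_roots = (let ps = [R10, R01, R11, R21, R31, R32] in map Pos ps @ map Neg ps)"

definition all_basis :: "g2_basis list" where
  "all_basis = Ha # Hb # map E all_roots"

fun sparse :: "g2_basis \<Rightarrow> g2_basis \<Rightarrow> (int \<times> g2_basis) list" where
  "sparse (E r) (E s) =
     (if coords r + coords s = 0
      then [(fst (coords r) * g2_form (1, 0) (1, 0) div g2_form (coords r) (coords r), Ha),
            (snd (coords r) * g2_form (0, 1) (0, 1) div g2_form (coords r) (coords r), Hb)]
      else map (\<lambda>t. (sample r s, E t)) (filter (\<lambda>t. coords t = coords r + coords s) all_roots))"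
| "sparse Ha (E s) = [(cartan_int s (Pos R10), E s)]"
| "sparse Hb (E s) = [(cartan_int s (Pos R01), E s)]"
| "sparse (E r) Ha = [(- cartan_int r (Pos R10), E r)]"
| "sparse (E r) Hb = [(- cartan_int r (Pos R01), E r)]"
| "sparse _ _ = []"

definition dense :: "(int \<times> g2_basis) list \<Rightarrow> int ^ g2_basis" where
  "dense l = (\<Sum>(c, b)\<leftarrow>l. c *s axis b 1)"

definition nested :: "g2_basis \<Rightarrow> g2_basis \<Rightarrow> g2_basis \<Rightarrow> (int \<times> g2_basis) list" where
  "nested x y z = concat (map (\<lambda>(c, b). map (\<lambda>(d, k). (c * d, k)) (sparse x b)) (sparse y z))"

definition vanishes :: "(int \<times> g2_basis) list \<Rightarrow> bool" where
  "vanishes l \<longleftrightarrow> list_all (\<lambda>(_, m). sum_list (map fst (filter (\<lambda>(_, k). k = m) l)) = 0) l"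

lemma all_roots: "distinct all_roots" "set all_roots = UNIV"
  by (auto simp: all_roots_def UNIV_g2_root UNIV_g2_pos)

lemma all_basis: "set all_basis = UNIV"
  by (auto simp: all_basis_def UNIV_g2_basis all_roots)

primrec all_pairs :: "('a \<Rightarrow> 'a \<Rightarrow> bool) \<Rightarrow> 'a list \<Rightarrow> bool" where
  "all_pairs P [] \<longleftrightarrow> True"
| "all_pairs P (x # xs) \<longleftrightarrow> list_all (P x) xs \<and> all_pairs P xs"

primrec all_triples :: "('a \<Rightarrow> 'a \<Rightarrow> 'a \<Rightarrow> bool) \<Rightarrow> 'a list \<Rightarrow> bool" where
  "all_triples P [] \<longleftrightarrow> True"
| "all_triples P (x # xs) \<longleftrightarrow> all_pairs (P x) xs \<and> all_triples P xs"

lemma all_pairsD: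
  assumes "all_pairs P l" "\<And>x y. P x y \<Longrightarrow> P y x" "\<And>x. P x x" "x \<in> set l" "y \<in> set l"
  shows "P x y"
  using assms(1,4,5)
proof (induction l)
  case (Cons u l)
  then have "\<forall>v\<in>set l. P u v" "\<forall>v\<in>set l. \<forall>w\<in>set l. P v w \<or> \<not> (x = v \<and> y = w)"
    by (auto simp: list_all_iff)
  with Cons.prems(2,3) show ?case
    using assms(2,3) by (metis set_ConsD)
qed simp

lemma all_triplesD:
  assumes "all_triples P l" "\<And>x y z. P x y z \<Longrightarrow> P y z x" "\<And>x y z. P x y z \<Longrightarrow> P y x z"
    "\<And>x y. P x x y" "x \<in> set l" "y \<in> set l" "z \<in> set l"
  shows "P x y z"
  using assms(1,5,6,7)
proof (induction l)
  case (Cons u l)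
  have head: "P u v w" if "v \<in> set l" "w \<in> set l" for v w
  proof (rule all_pairsD[of "P u" l])
    show "P u t s" if "P u s t" for s t
      using assms(2)[OF assms(3)[OF assms(2)[OF assms(2)[OF that]]]] assms(3) assms(2) that by metis
    show "P u s s" for s
      by (rule assms(2)[OF assms(2)[OF assms(4)]])
  qed (use Cons.prems that in simp_all)
  have IH: "P x y z" if "x \<in> set l" "y \<in> set l" "z \<in> set l"
    using Cons.IH Cons.prems that by simp
  have eq: "P v v w" "P v w v" "P w v v" for v w
    by (rule assms(4) assms(2)[OF assms(2)[OF assms(4)]] assms(2)[OF assms(4)])+
  show ?case
    using Cons.prems(2,3,4) head IH eq assms(2) by (metis set_ConsD)
qed simp

lemma jacobi_check:
  "all_triples (\<lambda>x y z. vanishes (nested x y z @ nested y z x @ nested z x y)) all_basis"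
  by code_simp

lemma skew_check:
  "list_all (\<lambda>x. list_all (\<lambda>y. vanishes (sparse x y @ sparse y x)) all_basis) all_basis"
  by code_simp

lemma dense_append: "dense (l @ l') = dense l + dense l'"
  by (simp add: dense_def)

lemma dense_nth: "dense l $ m = sum_list (map fst (filter (\<lambda>(_, k). k = m) l))"
  by (induction l) (auto simp: dense_def axis_def)

lemma dense_vanishes:
  assumes "vanishes l"
  shows "dense l = 0"
proof (rule vec_eq_iff[THEN iffD2], rule allI)
  fix m
  show "dense l $ m = 0 $ m"
  proof (cases "m \<in> snd ` set l")
    case True
    with assms show ?thesis
      by (force simp: vanishes_def list_all_iff dense_nth)
  next
    case False
    then have "filter (\<lambda>(_, k). k = m) l = []"
      by (force simp: filter_empty_conv)
    then show ?thesis
      by (simp add: dense_nth)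
  qed
qed

lemma basis_bracket_sparse: "basis_bracket sample x y = dense (sparse x y)"
proof (cases "\<exists>r s. x = E r \<and> y = E s")
  case True
  then obtain r s where xy: "x = E r" "y = E s" by blast
  have "(\<Sum>t | coords t = coords r + coords s. sample r s *s axis (E t) 1) =
      (\<Sum>t\<in>set (filter (\<lambda>t. coords t = coords r + coords s) all_roots).
         sample r s *s axis (E t) 1 :: int ^ g2_basis)"
    by (simp add: all_roots)
  also have "\<dots> = dense (map (\<lambda>t. (sample r s, E t))
      (filter (\<lambda>t. coords t = coords r + coords s) all_roots))"
    by (subst sum.distinct_set_conv_list) (simp_all add: all_roots dense_def o_def)
  finally show ?thesis
    by (simp add: xy dense_def coroot_def)
next
  case False
  then show ?thesis
    by (cases x; cases y) (auto simp: dense_def)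
qed

lemma bracket_dense:
  "bracket sample (axis x 1) (dense l) =
     dense (concat (map (\<lambda>(c, b). map (\<lambda>(d, k). (c * d, k)) (sparse x b)) l))"
proof (induction l)
  case Nil
  then show ?case by (simp add: dense_def bracket_zero_right)
next
  case (Cons p l)
  obtain c b where p: "p = (c, b)" by (cases p)
  have scale: "dense (map (\<lambda>(d, k). (c * d, k)) l') = c *s dense l'" for l'
    by (induction l') (auto simp: dense_def vec_eq_iff algebra_simps)
  have "dense (p # l) = c *s axis b 1 + dense l"
    by (simp add: dense_def p)
  then show ?case
    using Cons.IH
    by (simp add: p bracket_add_right bracket_scale_right bracket_axis basis_bracket_sparse
        dense_append scale)
qed

lemma bracket_nested:
  "bracket sample (axis x 1) (bracket sample (axis y 1) (axis z 1)) = dense (nested x y z)"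
  by (simp add: bracket_axis basis_bracket_sparse bracket_dense nested_def)

lemma bracket_skew: "bracket sample u v = - bracket sample v u"
proof -
  have basis: "bracket sample (axis x 1) (axis y 1) + bracket sample (axis y 1) (axis x 1) = 0" for x y
  proof -
    have "vanishes (sparse x y @ sparse y x)"
      using skew_check by (simp add: list_all_iff all_basis)
    then show ?thesis
      by (simp add: bracket_axis basis_bracket_sparse flip: dense_append) (rule dense_vanishes)
  qed
  define S where "S u v = bracket sample u v + bracket sample v u" for u v
  have add: "S (u + u') v = S u v + S u' v" "S u (v + v') = S u v + S u v'" for u u' v v'
    by (simp_all add: S_def bracket_add_left bracket_add_right add_ac)
  have scale: "S (c *s u) (d *s v) = (c * d) *s S u v" for c d u v
    by (simp add: S_def bracket_scale_left bracket_scale_right vector_smult_assoc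
        vector_add_ldistrib mult_ac)
  have zero: "S 0 v = 0" "S u 0 = 0" for u v
    by (simp_all add: S_def bracket_zero_left bracket_zero_right)
  have "S u v = 0"
  proof (induction u rule: vec_axis_induct)
    case (3 c x)
    show ?case
      by (induction v rule: vec_axis_induct) (simp_all add: add zero scale basis[folded S_def])
  qed (simp_all add: add zero)
  then have "bracket sample u v + bracket sample v u = 0"
    by (simp add: S_def)
  then show ?thesis
    by (simp add: eq_neg_iff_add_eq_0)
qed

lemma bracket_alternating: "bracket sample u u = 0"
proof -
  have "bracket sample u u $ i = - bracket sample u u $ i" for i
    using bracket_skew[of u u] by (metis vector_uminus_component)
  then show ?thesis
    by (simp add: vec_eq_iff)
qed

definition jacobiator :: "int ^ g2_basis \<Rightarrow> int ^ g2_basis \<Rightarrow> int ^ g2_basis \<Rightarrow> int ^ g2_basis" where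
  "jacobiator u v w = bracket sample u (bracket sample v w) +
     bracket sample v (bracket sample w u) + bracket sample w (bracket sample u v)"

lemma bracket_uminus_right: "bracket sample u (- v) = - bracket sample u v"
  using bracket_add_right[of sample u v "- v"]
  by (simp add: bracket_zero_right eq_neg_iff_add_eq_0 add.commute)

lemma jacobiator_swap: "jacobiator v u w = - jacobiator u v w"
  using bracket_skew[of v u] bracket_skew[of u w] bracket_skew[of w v]
  by (simp add: jacobiator_def bracket_uminus_right)

lemma jacobiator_axis: "jacobiator (axis x 1) (axis y 1) (axis z 1) = 0"
proof -
  let ?P = "\<lambda>x y z. dense (nested x y z @ nested y z x @ nested z x y) = 0"
  have P: "?P x y z \<longleftrightarrow> jacobiator (axis x 1) (axis y 1) (axis z 1) = 0" for x y z
    by (simp add: jacobiator_def bracket_nested dense_append add.assoc)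
  have mono: "all_triples Q l" if "all_triples R l" "\<And>x y z. R x y z \<Longrightarrow> Q x y z"
    for Q R and l :: "g2_basis list"
  proof -
    have pairs: "all_pairs Q' l'" if "all_pairs R' l'" "\<And>x y. R' x y \<Longrightarrow> Q' x y"
      for Q' R' and l' :: "g2_basis list"
      using that by (induction l') (auto simp: list_all_iff)
    show ?thesis
      using that by (induction l) (auto elim: pairs)
  qed
  have "?P x y z"
  proof (rule all_triplesD[where P = ?P and l = all_basis])
    show "all_triples ?P all_basis"
      by (rule mono[OF jacobi_check]) (rule dense_vanishes)
    show "?P y z x" if "?P x y z" for x y z
      using that by (simp add: dense_append add_ac)
    show "?P y x z" if "?P x y z" for x y z
      using that unfolding P by (simp add: jacobiator_swap[of "axis y 1"])
    show "?P x x y" for x y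
    proof -
      have "jacobiator (axis x 1) (axis x 1) (axis y 1) $ i = 0" for i
        using arg_cong[OF jacobiator_swap[of "axis x 1" "axis x 1" "axis y 1"], of "\<lambda>v. v $ i"]
        by simp
      then show ?thesis
        unfolding P by (simp add: vec_eq_iff)
    qed
  qed (simp_all add: all_basis)
  then show ?thesis
    by (simp add: P)
qed

lemma jacobiator_add:
  "jacobiator (u + u') v w = jacobiator u v w + jacobiator u' v w"
  "jacobiator u (v + v') w = jacobiator u v w + jacobiator u v' w"
  "jacobiator u v (w + w') = jacobiator u v w + jacobiator u v w'"
  by (simp_all add: jacobiator_def bracket_add_left bracket_add_right add_ac)

lemma jacobiator_scale: "jacobiator (a *s u) (b *s v) (c *s w) = (a * b * c) *s jacobiator u v w"
  by (simp add: jacobiator_def bracket_scale_left bracket_scale_right vector_smult_assoc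
      vector_add_ldistrib mult_ac)

lemma jacobiator_zero_arg: "jacobiator 0 v w = 0" "jacobiator u 0 w = 0" "jacobiator u v 0 = 0"
  by (simp_all add: jacobiator_def bracket_zero_left bracket_zero_right)

lemma jacobiator_zero: "jacobiator u v w = 0"
proof (induction u rule: vec_axis_induct)
  case (3 a x)
  show ?case
  proof (induction v rule: vec_axis_induct)
    case (3 b y)
    show ?case
      by (induction w rule: vec_axis_induct)
        (simp_all add: jacobiator_add jacobiator_zero_arg jacobiator_scale jacobiator_axis)
  qed (simp_all add: jacobiator_add jacobiator_zero_arg)
qed (simp_all add: jacobiator_add jacobiator_zero_arg)

definition in_string :: "g2_root \<Rightarrow> g2_root \<Rightarrow> nat \<Rightarrow> bool" where
  "in_string r s p \<longleftrightarrow> list_ex (\<lambda>t. coords t = (fst (coords s) - int p * fst (coords r),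
     snd (coords s) - int p * snd (coords r))) all_roots"

lemma depth_check:
  "list_all (\<lambda>r. list_all (\<lambda>s. list_all (\<lambda>t. coords t \<noteq> coords r + coords s \<or>
     sample r s \<noteq> 0 \<and> in_string r s (nat \<bar>sample r s\<bar> - 1) \<and>
     list_all (\<lambda>q. \<not> in_string r s q) [nat \<bar>sample r s\<bar>..<7]) all_roots) all_roots) all_roots"
  by code_simp

lemma string_depth_sample:
  assumes "coords t = coords r + coords s"
  shows "\<bar>sample r s\<bar> = int (string_depth r s) + 1"
proof -
  define p where "p = nat \<bar>sample r s\<bar> - 1"
  have check: "sample r s \<noteq> 0 \<and> in_string r s p \<and>
      (\<forall>q\<in>set [nat \<bar>sample r s\<bar>..<7]. \<not> in_string r s q)"
    using depth_check assms unfolding list_all_iff all_roots p_def by blast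
  have *: "sample r s \<noteq> 0" "in_string r s p" "\<And>q. p < q \<Longrightarrow> q < 7 \<Longrightarrow> \<not> in_string r s q"
  proof -
    fix q assume "p < q" "q < 7"
    then have "q \<in> set [nat \<bar>sample r s\<bar>..<7]"
      by (auto simp: p_def)
    with check show "\<not> in_string r s q" by blast
  qed (use check in blast)+
  have bound: "\<bar>fst (coords u)\<bar> \<le> 3 \<and> \<bar>snd (coords u)\<bar> \<le> 3 \<and> coords u \<noteq> 0" for u
  proof (cases u)
    case (Pos p)
    then show ?thesis by (cases p) (auto simp: zero_prod_def)
  next
    case (Neg p)
    then show ?thesis by (cases p) (auto simp: zero_prod_def)
  qed
  have small: "q < 7" if str: "in_string r s q" for q
  proof (rule ccontr)
    assume "\<not> q < 7"
    then have q: "int q \<ge> 7" by simp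
    obtain t where t0: "coords t = (fst (coords s) - int q * fst (coords r),
        snd (coords s) - int q * snd (coords r))"
      using str unfolding in_string_def list_ex_iff by blast
    have t: "int q * fst (coords r) = fst (coords s) - fst (coords t)"
      "int q * snd (coords r) = snd (coords s) - snd (coords t)"
      using arg_cong[OF t0, of fst] arg_cong[OF t0, of snd] by simp_all
    have big: "\<bar>int q * c\<bar> \<ge> 7" if "c \<noteq> 0" for c
    proof -
      have "7 * 1 \<le> int q * \<bar>c\<bar>"
        using that q by (intro mult_mono) auto
      then show ?thesis
        by (simp add: abs_mult)
    qed
    have "fst (coords r) = 0"
      using big[of "fst (coords r)"] t(1) bound[of s] bound[of t] by linarith
    moreover have "snd (coords r) = 0"
      using big[of "snd (coords r)"] t(2) bound[of s] bound[of t] by linarith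
    ultimately show False
      using bound[of r] by (simp add: prod_eq_iff)
  qed
  have "string_depth r s = p"
    unfolding string_depth_def
  proof (rule Greatest_equality)
    show "\<exists>t. coords t = (fst (coords s) - int p * fst (coords r),
        snd (coords s) - int p * snd (coords r))"
      using *(2) by (simp add: in_string_def list_ex_iff all_roots)
  next
    fix q
    assume "\<exists>t. coords t = (fst (coords s) - int q * fst (coords r),
        snd (coords s) - int q * snd (coords r))"
    then have "in_string r s q"
      by (simp add: in_string_def list_ex_iff all_roots)
    then show "q \<le> p"
      using *(3) small not_le by blast
  qed
  then show ?thesis
    using *(1) by (simp add: p_def)
qed

lemma chevalley_constants_sample: "chevalley_constants sample"
  using bracket_alternating jacobiator_zero string_depth_sample
  by (auto simp: chevalley_constants_def jacobiator_def)

end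

theory Submission
  imports Defs "HOL-Number_Theory.Residues"
begin

text \<open>
  Signs are invisible in characteristic two, so any family \<open>N\<close> of Chevalley structure constants
  yields the same root elements as the explicit family \<open>sample\<close> (\<open>root_elt_columns\<close>), and these
  can be computed column by column.

  Restricted to \<open>H\<close>, the 14-dimensional Lie algebra is the sum of two pieces.  Write \<open>V\<^sub>1, V\<^sub>2\<close> for
  the natural modules of the two factors \<open>SL\<^sub>2\<close>, and a prime for a Frobenius twist.  One piece, of
  dimension 6, is spanned by the Cartan subalgebra and the root vectors at \<open>\<plusminus>(3a+2b)\<close> and
  \<open>\<plusminus>a\<close>; the vector \<open>h\<^sub>a\<close> is fixed by \<open>H\<close> and spans the image of both coroots, because
  \<open>h\<^bsub>3a+2b\<^esub> = h\<^sub>a + 2 h\<^sub>b\<close>.  The other piece is spanned by the eight root vectors at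
  the remaining roots.  These form two \<open>a\<close>-strings of length four, on each of which the divided
  powers turn the cubic representation into \<open>V\<^sub>2 \<otimes> V\<^sub>2'\<close>, so the piece is
  \<open>V\<^sub>1 \<otimes> V\<^sub>2 \<otimes> V\<^sub>2'\<close>.  Hence every element of \<open>H\<close> is an explicit matrix \<open>H_mat A B\<close>, with
  \<open>A\<close> and \<open>B\<close> of determinant 1 (\<open>H_mat_mult\<close>, \<open>generate_H_group\<close>).  The map \<open>H_mat\<close> is
  injective and the centre of \<open>SL\<^sub>2\<close> is trivial in characteristic two, which gives the isomorphism
  with \<open>L\<^sub>2(q) \<times> L\<^sub>2(q)\<close>.

  An element \<open>h'\<close> of \<open>H \<inter> H\<^sup>g\<close> is \<open>g\<^sup>-\<^sup>1 h g\<close> with \<open>h\<close> in \<open>H\<close>, so that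
  \<open>h g = g h'\<close>.  Comparing seven entries of the two
  products already forces \<open>h = 1\<close> (\<open>intertwiner_trivial\<close>).  The claim on the base size follows
  formally: \<open>{1, g}\<close> is a base, and no smaller set is one since \<open>H \<noteq> 1\<close>.
\<close>

section \<open>Signs disappear in characteristic two\<close>

text \<open>The integral vectors that lie in a single weight space.  The powers of \<open>ad e\<^sub>r\<close> keep a basis
  vector within such vectors, and this makes a change of the signs in \<open>N\<close> act by one common sign.\<close>

definition weight_vector :: "int ^ g2_basis \<Rightarrow> bool" where
  "weight_vector v \<longleftrightarrow>
     (\<exists>c s. v = c *s axis (E s) 1) \<or> (\<exists>c d. v = c *s axis Ha 1 + d *s axis Hb 1)"

lemma coords_inject: "coords s = coords t \<longleftrightarrow> s = t"
proof -
  have "pos_coords p = pos_coords q \<longleftrightarrow> p = q" "pos_coords p \<noteq> - pos_coords q" for p q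
    by (cases p; cases q; simp)+
  then show ?thesis
    by (cases s; cases t) (simp_all, metis)
qed

lemma matrix_mult_axis: "(M *v axis j 1) $ i = M $ i $ j"
  for M :: "int ^ 'n ^ 'm"
  by (simp add: matrix_vector_mult_def axis_def if_distrib cong: if_cong)

lemma ad_root_mult: "ad_root N r *v v = bracket N (axis (E r) 1) v"
proof (induction v rule: vec_axis_induct)
  case 1
  show ?case by (simp add: bracket_zero_right)
next
  case (2 u v)
  then show ?case by (simp add: bracket_add_right matrix_vector_right_distrib)
next
  case (3 c x)
  have "ad_root N r *v axis x 1 = bracket N (axis (E r) 1) (axis x 1)"
    by (simp add: vec_eq_iff matrix_mult_axis) (simp add: ad_root_def)
  moreover have "ad_root N r *v (c *s axis x 1) = c *s (ad_root N r *v axis x 1)"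
    by (simp add: matrix_vector_mult_def vec_eq_iff sum_distrib_left mult_ac)
  ultimately show ?case
    by (simp add: bracket_scale_right)
qed

lemma bracket_root:
  assumes "coords t = coords r + coords s"
  shows "basis_bracket N (E r) (E s) = N r s *s axis (E t) 1"
proof -
  have "coords t \<noteq> 0"
    by (cases t; rename_tac p; case_tac p) (simp_all add: zero_prod_def)
  moreover have "{u. coords u = coords r + coords s} = {t}"
    unfolding assms[symmetric] coords_inject by simp
  ultimately show ?thesis
    by (simp flip: assms)
qed

text \<open>Only the brackets of two root vectors involve \<open>N\<close>, and there the absolute value of \<open>N r s\<close> is
  dictated by the root string.\<close>

lemma bracket_sign:
  assumes N: "chevalley_constants N" and v: "weight_vector v"
  shows "\<exists>\<sigma>\<in>{1, -1}. bracket N (axis (E r) 1) v = \<sigma> *s bracket sample (axis (E r) 1) v"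
    and "weight_vector (bracket N (axis (E r) 1) v)"
proof -
  from v consider (root) c s where "v = c *s axis (E s) 1"
    | (toral) c d where "v = c *s axis Ha 1 + d *s axis Hb 1"
    unfolding weight_vector_def by blast
  then have "(\<exists>\<sigma>\<in>{1, -1}. bracket N (axis (E r) 1) v = \<sigma> *s bracket sample (axis (E r) 1) v) \<and>
     weight_vector (bracket N (axis (E r) 1) v)"
  proof cases
    case v: root
    show ?thesis
    proof (cases "coords r + coords s = 0")
      case True
      have eq: "bracket M (axis (E r) 1) v = c *s coroot r" for M
        using True by (simp add: v bracket_scale_right bracket_axis)
      have "\<exists>c' d. c *s coroot r = c' *s axis Ha 1 + d *s axis Hb 1"
        unfolding coroot_def vector_add_ldistrib vector_smult_assoc by blast
      then show ?thesis
        unfolding eq weight_vector_def by (intro conjI bexI[of _ 1] disjI2) simp_all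
    next
      case False
      show ?thesis
      proof (cases "\<exists>t. coords t = coords r + coords s")
        case True
        then obtain t where t: "coords t = coords r + coords s" by blast
        have eq: "bracket M (axis (E r) 1) v = (c * M r s) *s axis (E t) 1" for M
          by (simp add: v bracket_scale_right bracket_axis bracket_root[OF t] vector_smult_assoc
              del: basis_bracket.simps)
        have "\<bar>N r s\<bar> = \<bar>sample r s\<bar>"
          using N string_depth_sample t unfolding chevalley_constants_def by metis
        then consider "N r s = sample r s" | "N r s = - sample r s" by linarith
        then have "\<exists>\<sigma>\<in>{1, -1}. (c * N r s) *s axis (E t) 1 =
            \<sigma> *s ((c * sample r s) *s axis (E t) 1)"
          by cases (auto simp: vector_smult_assoc)
        then show ?thesis
          unfolding eq weight_vector_def by blast
      next
        case False
        then have "basis_bracket M (E r) (E s) = 0" for M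
          using \<open>coords r + coords s \<noteq> 0\<close> by simp
        then have eq: "bracket M (axis (E r) 1) v = 0 *s axis (E r) 1" for M
          by (simp add: v bracket_scale_right bracket_axis del: basis_bracket.simps)
        show ?thesis
          unfolding eq weight_vector_def vector_smult_assoc mult_zero_right by blast
      qed
    qed
  next
    case v: toral
    have eq: "bracket M (axis (E r) 1) v =
       (- c * cartan_int r (Pos R10) - d * cartan_int r (Pos R01)) *s axis (E r) 1" for M
      by (simp add: v bracket_add_right bracket_scale_right bracket_axis vec_eq_iff algebra_simps)
    show ?thesis
      unfolding eq weight_vector_def
      by (intro conjI bexI[of _ 1] disjI1 exI) (rule refl vector_smult_lid[symmetric] insertI1)+
  qed
  then show "\<exists>\<sigma>\<in>{1, -1}. bracket N (axis (E r) 1) v = \<sigma> *s bracket sample (axis (E r) 1) v"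
    and "weight_vector (bracket N (axis (E r) 1) v)" by auto
qed

lemma ad_power_Suc: "((**) A ^^ Suc n) (mat 1) *v v = A *v (((**) A ^^ n) (mat 1) *v v)"
  by (simp add: matrix_vector_mul_assoc)

lemma ad_power_sign:
  assumes "chevalley_constants N"
  shows "\<exists>\<sigma>\<in>{1, -1}. ((**) (ad_root N r) ^^ n) (mat 1) *v axis j 1 =
     \<sigma> *s (((**) (ad_root sample r) ^^ n) (mat 1) *v axis j 1)
     \<and> weight_vector (((**) (ad_root sample r) ^^ n) (mat 1) *v axis j 1)"
proof (induction n)
  case 0
  have "weight_vector (axis j 1)"
  proof (cases j)
    case (E s)
    then have "axis j 1 = 1 *s axis (E s) (1::int)" by simp
    then show ?thesis unfolding weight_vector_def by blast
  next
    case Ha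
    then have "axis j 1 = 1 *s axis Ha (1::int) + 0 *s axis Hb 1" by simp
    then show ?thesis unfolding weight_vector_def by blast
  next
    case Hb
    then have "axis j 1 = 0 *s axis Ha (1::int) + 1 *s axis Hb 1" by simp
    then show ?thesis unfolding weight_vector_def by blast
  qed
  then show ?case by simp
next
  case (Suc n)
  define v where "v = ((**) (ad_root sample r) ^^ n) (mat 1) *v axis j 1"
  from Suc obtain \<sigma> where \<sigma>: "\<sigma> \<in> {1, -1}" "weight_vector v"
    "((**) (ad_root N r) ^^ n) (mat 1) *v axis j 1 = \<sigma> *s v"
    unfolding v_def by blast
  from bracket_sign(1)[OF assms \<sigma>(2), of r] obtain \<tau> where \<tau>: "\<tau> \<in> {1, -1}"
    "bracket N (axis (E r) 1) v = \<tau> *s bracket sample (axis (E r) 1) v" by blast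
  have "\<sigma> * \<tau> \<in> {1, -1}" using \<sigma>(1) \<tau>(1) by auto
  moreover have "weight_vector (bracket sample (axis (E r) 1) v)"
    by (rule bracket_sign(2)[OF chevalley_constants_sample \<sigma>(2)])
  ultimately show ?case
    unfolding ad_power_Suc ad_root_mult \<sigma>(3) bracket_scale_right \<tau>(2) v_def[symmetric]
      vector_smult_assoc by blast
qed

section \<open>Root elements modulo two\<close>

definition coeff_at :: "(int \<times> g2_basis) list \<Rightarrow> g2_basis \<Rightarrow> int" where
  "coeff_at l i = sum_list (map fst (filter (\<lambda>(_, k). k = i) l))"

text \<open>Columns of powers of \<open>ad e\<^sub>r\<close>, in the representation of vectors as lists of pairs of a coefficient
  and a basis element, are evaluated by rewriting.\<close>

definition ad_step :: "g2_root \<Rightarrow> (int \<times> g2_basis) list \<Rightarrow> (int \<times> g2_basis) list" where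
  "ad_step r l = concat (map (\<lambda>(c, b). map (\<lambda>(d, k). (c * d, k)) (sparse (E r) b)) l)"

definition ad_column :: "g2_root \<Rightarrow> nat \<Rightarrow> g2_basis \<Rightarrow> (int \<times> g2_basis) list" where
  "ad_column r n j = (ad_step r ^^ n) [(1, j)]"

lemma ad_column: "((**) (ad_root sample r) ^^ n) (mat 1) *v axis j 1 = dense (ad_column r n j)"
proof (induction n)
  case 0
  show ?case by (simp add: ad_column_def dense_def)
next
  case (Suc n)
  show ?case
    unfolding ad_power_Suc Suc ad_root_mult bracket_dense by (simp add: ad_column_def ad_step_def)
qed

lemma ad_power_entry:
  assumes "chevalley_constants N"
  shows "\<exists>\<sigma>\<in>{1, -1}. ((**) (ad_root N r) ^^ n) (mat 1) $ i $ j = \<sigma> * coeff_at (ad_column r n j) i"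
  using ad_power_sign[OF assms, of n r j]
  by (auto simp: ad_column dense_nth coeff_at_def simp flip: matrix_mult_axis)

text \<open>Integrality of the divided powers, by inspection of the structure constants \<open>sample\<close>.  A sign
  does not affect it, so it carries over to all Chevalley bases.\<close>

lemma divisibility_check:
  "list_all (\<lambda>r. list_all (\<lambda>j. list_all (\<lambda>n. let l = ad_column r n j in
     list_all (\<lambda>i. fact n dvd coeff_at l i) all_basis) [0, 1, 2, 3]) all_basis) all_roots"
  by code_simp

lemma fact_dvd_coeff_at:
  assumes "n \<le> 3"
  shows "fact n dvd coeff_at (ad_column r n j) i"
proof -
  from assms have "n \<in> set [0, 1, 2, 3]" by auto
  then show ?thesis
    using divisibility_check unfolding list_all_iff Let_def all_basis all_roots by blast
qed

text \<open>The column of \<open>x\<^sub>r(t)\<close> at \<open>j\<close> modulo two: the pair \<open>(n, i)\<close> stands for the term \<open>t\<^sup>n\<close> in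
  row \<open>i\<close>.\<close>

definition root_columns :: "g2_root \<Rightarrow> g2_basis \<Rightarrow> (nat \<times> g2_basis) list" where
  "root_columns r j = concat (map (\<lambda>n. let l = ad_column r n j in
     map (Pair n) (filter (\<lambda>i. odd (coeff_at l i div fact n)) all_basis)) [0, 1, 2, 3])"

definition entry_at :: "(nat \<times> g2_basis) list \<Rightarrow> 'k::field \<Rightarrow> g2_basis \<Rightarrow> 'k" where
  "entry_at l t i = (\<Sum>(n, k)\<leftarrow>l. if k = i then t ^ n else 0)"

definition column_matrix ::
  "(g2_basis \<Rightarrow> (nat \<times> g2_basis) list) \<Rightarrow> 'k::field \<Rightarrow> 'k ^ g2_basis ^ g2_basis" where
  "column_matrix F t = (\<chi> i j. entry_at (F j) t i)"

lemma of_int_parity: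
  assumes "(2 :: 'k::field) = 0"
  shows "(of_int x :: 'k) = of_bool (odd x)"
proof -
  have "(of_int x :: 'k) = of_int (2 * (x div 2) + x mod 2)" by simp
  also have "\<dots> = of_int (x mod 2)"
    using assms by (simp only: of_int_add of_int_mult of_int_numeral) simp
  also have "\<dots> = of_bool (odd x)"
    by (cases "even x") (simp_all add: odd_iff_mod_2_eq_one)
  finally show ?thesis .
qed

lemma distinct_all_basis: "distinct all_basis"
  using all_roots(1) by (auto simp: all_basis_def distinct_map inj_on_def)

text \<open>The integral coefficients of \<open>x\<^sub>r(t)\<close> for \<open>N\<close> and for \<open>sample\<close> differ by signs, hence agree
  in \<open>'k\<close>, where only their parity counts.\<close>

lemma root_elt_columns:
  assumes "(2 :: 'k::field) = 0" "chevalley_constants N"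
  shows "root_elt N r (t :: 'k) = column_matrix (root_columns r) t"
proof -
  have 1: "(of_int (ad_divided_power N r n $ i $ j) :: 'k) =
      of_bool (odd (coeff_at (ad_column r n j) i div fact n))" if "n \<le> 3" for n i j
  proof -
    obtain \<sigma> where "\<sigma> \<in> {1, -1}"
      "((**) (ad_root N r) ^^ n) (mat 1) $ i $ j = \<sigma> * coeff_at (ad_column r n j) i"
      using ad_power_entry[OF assms(2)] by blast
    then show ?thesis
      using fact_dvd_coeff_at[OF that, of r j i] by (auto simp: ad_divided_power_def of_int_parity[OF assms(1)] dvd_neg_div)
  qed
  have 2: "(\<Sum>k\<leftarrow>filter P all_basis. if k = i then c else 0) = of_bool (P i) * c"
    for P i and c :: 'k
  proof -
    have "(\<Sum>k\<leftarrow>filter P all_basis. if k = i then c else 0) =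
        (\<Sum>k\<in>set (filter P all_basis). if k = i then c else 0)"
      using distinct_all_basis by (subst sum.distinct_set_conv_list) simp_all
    then show ?thesis
      by (simp add: all_basis)
  qed
  have "root_elt N r t $ i $ j = column_matrix (root_columns r) t $ i $ j" for i j
  proof -
    have "root_elt N r t $ i $ j =
        (\<Sum>n\<in>set [0, 1, 2, 3]. of_bool (odd (coeff_at (ad_column r n j) i div fact n)) * t ^ n)"
      unfolding root_elt_def using 1 by (auto simp: intro!: sum.cong)
    also have "\<dots> = (\<Sum>n\<leftarrow>[0, 1, 2, 3].
        \<Sum>k\<leftarrow>filter (\<lambda>k. odd (coeff_at (ad_column r n j) k div fact n)) all_basis.
          if k = i then t ^ n else 0)"
      unfolding 2 by (subst sum.distinct_set_conv_list) simp_all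
    also have "\<dots> = column_matrix (root_columns r) t $ i $ j"
      by (simp add: column_matrix_def entry_at_def root_columns_def Let_def o_def)
    finally show ?thesis .
  qed
  then show ?thesis
    by (simp add: vec_eq_iff)
qed

section \<open>The exponential law\<close>

lemma nilpotency_check:
  "list_all (\<lambda>r. list_all (\<lambda>j. let l = ad_column r 4 j in
     list_all (\<lambda>i. coeff_at l i = 0) all_basis) all_basis) all_roots"
  by code_simp

lemma ad_power_add: "((**) A ^^ (m + n)) (mat 1) = ((**) A ^^ m) (mat 1) ** ((**) A ^^ n) (mat 1)"
  for A :: "'a::semiring_1 ^ 'n ^ 'n"
  by (induction m) (simp_all add: matrix_mul_assoc)

lemma ad_power_nilpotent:
  assumes "chevalley_constants N" "n \<ge> 4"
  shows "((**) (ad_root N r) ^^ n) (mat 1) = 0"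
proof -
  have "coeff_at (ad_column r 4 j) i = 0" for i j
    using nilpotency_check unfolding list_all_iff Let_def all_basis all_roots by blast
  then have "((**) (ad_root N r) ^^ 4) (mat 1) = 0"
    using ad_power_entry[OF assms(1), of 4 r] by (force simp: vec_eq_iff)
  then have "((**) (ad_root N r) ^^ (n - 4 + 4)) (mat 1) = 0"
    unfolding ad_power_add by (simp add: matrix_matrix_mult_def vec_eq_iff)
  with assms(2) show ?thesis by simp
qed

lemma ad_divided_power_fact:
  assumes "chevalley_constants N"
  shows "((**) (ad_root N r) ^^ n) (mat 1) $ i $ j = fact n * ad_divided_power N r n $ i $ j"
proof (cases "n \<ge> 4")
  case True
  then show ?thesis
    by (simp add: ad_divided_power_def ad_power_nilpotent[OF assms])
next
  case False
  then have "(fact n :: int) dvd coeff_at (ad_column r n j) i"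
    by (intro fact_dvd_coeff_at) simp
  then have "(fact n :: int) dvd ((**) (ad_root N r) ^^ n) (mat 1) $ i $ j"
    using ad_power_entry[OF assms, of n r i j] by auto
  then show ?thesis
    by (simp add: ad_divided_power_def)
qed

text \<open>The identity \<open>x\<^sup>m/m! \<sqdot> x\<^sup>n/n! = (m + n choose m) x\<^sup>m\<^sup>+\<^sup>n/(m + n)!\<close> holds over the integers because
  the factorials can be cancelled there.\<close>

lemma ad_divided_power_mult:
  assumes "chevalley_constants N"
  shows "(ad_divided_power N r m ** ad_divided_power N r n) $ i $ j =
     int ((m + n) choose m) * ad_divided_power N r (m + n) $ i $ j"
proof -
  let ?C = "ad_divided_power N r"
  have "fact m * fact n * (?C m ** ?C n) $ i $ j =
      (\<Sum>k\<in>UNIV. (fact m * ?C m $ i $ k) * (fact n * ?C n $ k $ j))"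
    by (simp add: matrix_matrix_mult_def sum_distrib_left mult_ac)
  also have "\<dots> = fact (m + n) * ?C (m + n) $ i $ j"
    unfolding ad_divided_power_fact[OF assms, symmetric] ad_power_add by (simp add: matrix_matrix_mult_def)
  also have "fact (m + n) = fact m * fact n * int ((m + n) choose m)"
    using binomial_fact_lemma[of m "m + n"] by (metis add_diff_cancel_left' le_add1 of_nat_fact of_nat_mult)
  finally show ?thesis by simp
qed

lemma ad_divided_power_nilpotent:
  assumes "chevalley_constants N" "n \<ge> 4"
  shows "ad_divided_power N r n = 0"
  by (simp add: ad_divided_power_def ad_power_nilpotent[OF assms] vec_eq_iff)

text \<open>The binomial theorem turns the previous identity into the exponential law; truncation at \<open>n = 3\<close>
  loses nothing by nilpotency.  It is used to see that root elements of all twelve roots are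
  invertible, so that \<open>G\<close> is a group of matrices.\<close>

lemma root_elt_add:
  assumes "chevalley_constants N"
  shows "root_elt N r s ** root_elt N r t = (root_elt N r (s + t) :: 'k::field ^ g2_basis ^ g2_basis)"
proof -
  let ?C = "ad_divided_power N r"
  have "(root_elt N r s ** root_elt N r t) $ i $ j = root_elt N r (s + t) $ i $ j" for i j
  proof -
    have "(root_elt N r s ** root_elt N r t) $ i $ j =
        (\<Sum>k\<in>UNIV. \<Sum>m\<le>3. \<Sum>n\<le>3. of_int (?C m $ i $ k * ?C n $ k $ j) * (s ^ m * t ^ n))"
      by (simp add: matrix_matrix_mult_def root_elt_def sum_product mult_ac)
    also have "\<dots> = (\<Sum>m\<le>3. \<Sum>n\<le>3. of_int ((?C m ** ?C n) $ i $ j) * (s ^ m * t ^ n))"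
      by (subst sum.swap, intro sum.cong refl, subst sum.swap)
        (simp add: matrix_matrix_mult_def sum_distrib_right)
    also have "\<dots> = (\<Sum>k\<le>3. of_int (?C k $ i $ j) * (s + t) ^ k)"
      by (simp add: ad_divided_power_mult[OF assms] ad_divided_power_nilpotent[OF assms]
          numeral_3_eq_3 numeral_2_eq_2 algebra_simps eval_nat_numeral)
    finally show ?thesis
      by (simp add: root_elt_def)
  qed
  then show ?thesis by (simp add: vec_eq_iff)
qed

lemma root_elt_zero: "root_elt N r 0 = mat 1"
  by (simp add: root_elt_def ad_divided_power_def mat_def vec_eq_iff power_0_left if_distrib sum.delta
      cong: if_cong)

lemma root_elt_invertible:
  assumes "chevalley_constants N"
  shows "invertible (root_elt N r t)"
  unfolding invertible_def
  using root_elt_add[OF assms, of r t "- t"] root_elt_add[OF assms, of r "- t" t]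
  by (auto simp: root_elt_zero)

section \<open>Symbolic products of matrices\<close>

lemma column_matrix_nth: "column_matrix F t $ i $ j = entry_at (F j) t i"
  by (simp add: column_matrix_def)

text \<open>Products of the matrices given by columns can be formed symbolically: the polynomials in \<open>t\<close> are
  multiplied by adding exponents.\<close>

definition column_comp ::
  "(g2_basis \<Rightarrow> (nat \<times> g2_basis) list) \<Rightarrow> (g2_basis \<Rightarrow> (nat \<times> g2_basis) list) \<Rightarrow>
     g2_basis \<Rightarrow> (nat \<times> g2_basis) list" where
  "column_comp F G j = concat (map (\<lambda>(n, k). map (\<lambda>(m, l). (n + m, l)) (F k)) (G j))"

lemma column_matrix_mult: "column_matrix F t ** column_matrix G t = column_matrix (column_comp F G) t"
proof -
  have shift: "entry_at (map (\<lambda>(m, l). (n + m, l)) l) t i = t ^ n * entry_at l t i" for n l i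
    by (induction l) (auto simp: entry_at_def power_add distrib_left)
  have "(\<Sum>k\<in>UNIV. entry_at (F k) t i * entry_at l t k) =
      entry_at (concat (map (\<lambda>(n, k). map (\<lambda>(m, l). (n + m, l)) (F k)) l)) t i" for l i
  proof (induction l)
    case (Cons p l)
    obtain n k where p: "p = (n, k)" by (cases p)
    have cons: "entry_at (F k') t i * entry_at ((n, k) # l) t k' =
        (if k = k' then t ^ n * entry_at (F k) t i else 0) + entry_at (F k') t i * entry_at l t k'" for k'
      by (simp add: entry_at_def distrib_left mult.commute)
    have app: "entry_at (l1 @ l2) t i = entry_at l1 t i + entry_at l2 t i" for l1 l2
      by (simp add: entry_at_def)
    show ?case
      using Cons.IH
      by (simp add: p cons app shift sum.distrib)
  qed (simp add: entry_at_def)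
  then show ?thesis
    by (simp add: vec_eq_iff matrix_matrix_mult_def column_matrix_nth column_comp_def)
qed

section \<open>Arithmetic in characteristic two\<close>

lemma char_2_arith:
  assumes "(2 :: 'k::field) = 0"
  shows "- x = (x :: 'k)" "x + y = 0 \<longleftrightarrow> x = y" "x - y = x + y"
proof -
  have double: "x + x = 0" for x :: 'k
    by (metis assms mult_2 mult_zero_left)
  then show "- x = x" by (metis minus_unique)
  then show "x - y = x + y" "x + y = 0 \<longleftrightarrow> x = y"
    using double
    by (metis add_diff_cancel_right' add.commute diff_conv_add_uminus double eq_iff_diff_eq_0)+
qed

lemma square_eq_one:
  assumes "(2 :: 'k::field) = 0"
  shows "x\<^sup>2 = 1 \<longleftrightarrow> x = (1 :: 'k)"
  using char_2_arith(1)[OF assms, of 1] by (auto simp: power2_eq_1_iff)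

text \<open>Two lists of terms have the same sum in characteristic two when each term occurs an even number
  of times in their concatenation.\<close>

definition even_list :: "'a list \<Rightarrow> bool" where
  "even_list l \<longleftrightarrow> list_all (\<lambda>x. even (count_list l x)) l"

lemma sum_list_even:
  assumes "(2 :: 'k::field) = 0" "even_list l"
  shows "(\<Sum>x\<leftarrow>l. f x) = (0 :: 'k)"
proof -
  have "(\<Sum>x\<leftarrow>l. f x) = (\<Sum>x\<in>X. of_nat (count_list l x) * f x)" if "set l \<subseteq> X" "finite X" for X
    using that
  proof (induction l)
    case (Cons a l)
    have "(\<Sum>x\<in>X. of_nat (count_list (a # l) x) * f x) =
        (\<Sum>x\<in>X. (if a = x then f x else 0) + of_nat (count_list l x) * f x)"
      by (intro sum.cong) (auto simp: algebra_simps)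
    then show ?case
      using Cons by (simp add: sum.distrib)
  qed simp
  from this[of "set l"] have "(\<Sum>x\<leftarrow>l. f x) = (\<Sum>x\<in>set l. of_nat (count_list l x) * f x)"
    by simp
  also have "\<dots> = 0"
  proof (intro sum.neutral ballI)
    fix x assume "x \<in> set l"
    then obtain m where "count_list l x = 2 * m"
      using assms(2) by (auto simp: even_list_def list_all_iff elim!: evenE)
    then show "of_nat (count_list l x) * f x = 0"
      by (simp add: assms(1))
  qed
  finally show ?thesis .
qed

lemma entry_at_cong:
  assumes "(2 :: 'k::field) = 0" "even_list (l @ l')"
  shows "entry_at l t i = entry_at l' (t :: 'k) i"
proof -
  have "entry_at l t i + entry_at l' t i = 0"
    using sum_list_even[OF assms, of "\<lambda>(n, k). if k = i then t ^ n else 0"]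
    by (simp add: entry_at_def)
  then show ?thesis
    by (simp add: char_2_arith(2)[OF assms(1)])
qed

section \<open>The element \<open>g\<close>\<close>

text \<open>The images under \<open>g\<close> of \<open>h\<^sub>a\<close> and of the root vectors at \<open>\<plusminus>a\<close> and \<open>\<plusminus>(3a+2b)\<close>, each a
  sum of distinct basis elements.  The comparison of \<open>h g\<close> with \<open>g h'\<close> is confined to these
  columns, because their span is invariant under \<open>H\<close>.\<close>

definition g_columns :: "(g2_basis \<times> g2_basis list) list" where
  "g_columns =
     [(Ha, [Ha, Hb, E (Pos R10), E (Pos R21), E (Pos R32), E (Neg R01)]),
      (E (Pos R10), [E (Pos R10), E (Pos R11), E (Pos R32)]),
      (E (Neg R10), [Ha, Hb, E (Pos R11), E (Neg R11)]),
      (E (Pos R32), [E (Pos R31)]),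
      (E (Neg R32), [E (Pos R01), E (Neg R10), E (Neg R21), E (Neg R31), E (Neg R32)])]"

lemma g_columns_check:
  "list_all (\<lambda>(j, l). distinct l \<and> even_list (map (\<lambda>p. (0 :: nat, snd p)) (column_comp (root_columns (Pos R01))
      (column_comp (root_columns (Pos R11)) (root_columns (Neg R01))) j) @ map (Pair 0) l)) g_columns"
  by code_simp

lemma g_entry:
  assumes "(2 :: 'k::field) = 0" "chevalley_constants N" "(j, l) \<in> set g_columns"
  shows "(root_elt N (Pos R01) 1 ** root_elt N (Pos R11) 1 ** root_elt N (Neg R01) 1
     :: 'k ^ g2_basis ^ g2_basis) $ i $ j = of_bool (i \<in> set l)"
proof -
  let ?F = "column_comp (root_columns (Pos R01))
      (column_comp (root_columns (Pos R11)) (root_columns (Neg R01))) j"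
  have check: "distinct l" "even_list (map (\<lambda>p. (0 :: nat, snd p)) ?F @ map (Pair 0) l)"
    using g_columns_check assms(3) unfolding list_all_iff by auto
  have "(root_elt N (Pos R01) 1 ** root_elt N (Pos R11) 1 ** root_elt N (Neg R01) 1
     :: 'k ^ g2_basis ^ g2_basis) $ i $ j = entry_at ?F 1 i"
    unfolding matrix_mul_assoc[symmetric]
    unfolding root_elt_columns[OF assms(1,2)] column_matrix_mult column_matrix_nth ..
  also have "\<dots> = entry_at (map (\<lambda>p. (0, snd p)) ?F) 1 i"
    by (simp add: entry_at_def o_def case_prod_unfold cong: if_cong)
  also have "\<dots> = entry_at (map (Pair 0) l) 1 i"
    by (rule entry_at_cong[OF assms(1) check(2)])
  also have "\<dots> = of_bool (i \<in> set l)"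
    using check(1) by (induction l) (auto simp: entry_at_def)
  finally show ?thesis .
qed

section \<open>The action of the subgroup on the Lie algebra\<close>

text \<open>\<open>HA\<close> and \<open>HB\<close> are \<open>h\<^sub>a\<close> and \<open>h\<^sub>b\<close>; \<open>First i\<close> and \<open>Second i\<close> are the root vectors at
  \<open>\<plusminus>(3a+2b)\<close> and \<open>\<plusminus>a\<close>; and \<open>Tensor i j k\<close> is the tensor \<open>v\<^sub>i \<otimes> v\<^sub>j \<otimes> v\<^sub>k\<close> in
  \<open>V\<^sub>1 \<otimes> V\<^sub>2 \<otimes> V\<^sub>2'\<close>.  The index 1 belongs to the vector of highest weight.\<close>

datatype block = HA | HB | First 2 | Second 2 | Tensor 2 2 2

text \<open>Raising by \<open>a\<close> changes \<open>j\<close> from 2 to 1 (one step in the \<open>a\<close>-string) or \<open>k\<close> from 2 to 1 (two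
  steps, the effect of the Frobenius twist); raising by \<open>3a+2b\<close> changes \<open>i\<close> from 2 to 1.\<close>

fun block_of :: "g2_basis \<Rightarrow> block" where
  "block_of Ha = HA"
| "block_of Hb = HB"
| "block_of (E (Pos R32)) = First 1"
| "block_of (E (Neg R32)) = First 2"
| "block_of (E (Pos R10)) = Second 1"
| "block_of (E (Neg R10)) = Second 2"
| "block_of (E (Pos R31)) = Tensor 1 1 1"
| "block_of (E (Pos R21)) = Tensor 1 2 1"
| "block_of (E (Pos R11)) = Tensor 1 1 2"
| "block_of (E (Pos R01)) = Tensor 1 2 2"
| "block_of (E (Neg R01)) = Tensor 2 1 1"
| "block_of (E (Neg R11)) = Tensor 2 2 1"
| "block_of (E (Neg R21)) = Tensor 2 1 2"
| "block_of (E (Neg R31)) = Tensor 2 2 2"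

text \<open>The squares are the Frobenius twists.  The entries in the row of \<open>h\<^sub>a\<close> and in the column of \<open>h\<^sub>b\<close>
  come from the adjoint action on \<open>sl\<^sub>2\<close>, where \<open>A e A\<^sup>-\<^sup>1\<close> has the \<open>h\<close>-coordinate
  \<open>A\<^sub>1\<^sub>1 A\<^sub>2\<^sub>1\<close> up to sign, and \<open>h\<^sub>b\<close> is half of \<open>h\<^bsub>3a+2b\<^esub> - h\<^sub>a\<close>: halving
  \<open>A h A\<^sup>-\<^sup>1 - h\<close> leaves \<open>A\<^sub>1\<^sub>2 A\<^sub>2\<^sub>1 h\<close>, \<open>A\<^sub>1\<^sub>1 A\<^sub>1\<^sub>2 e\<close> and \<open>A\<^sub>2\<^sub>1 A\<^sub>2\<^sub>2 f\<close>.\<close>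

fun block_entry :: "'k::field ^ 2 ^ 2 \<Rightarrow> 'k ^ 2 ^ 2 \<Rightarrow> block \<Rightarrow> block \<Rightarrow> 'k" where
  "block_entry A B HA HA = 1"
| "block_entry A B HB HB = 1"
| "block_entry A B HA HB = A $ 1 $ 2 * A $ 2 $ 1 + B $ 1 $ 2 * B $ 2 $ 1"
| "block_entry A B HA (First j) = A $ 1 $ j * A $ 2 $ j"
| "block_entry A B HA (Second j) = B $ 1 $ j * B $ 2 $ j"
| "block_entry A B (First i) HB = A $ i $ 1 * A $ i $ 2"
| "block_entry A B (Second i) HB = B $ i $ 1 * B $ i $ 2"
| "block_entry A B (First i) (First j) = (A $ i $ j)\<^sup>2"
| "block_entry A B (Second i) (Second j) = (B $ i $ j)\<^sup>2"
| "block_entry A B (Tensor i j k) (Tensor i' j' k') = A $ i $ i' * B $ j $ j' * (B $ k $ k')\<^sup>2"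
| "block_entry A B _ _ = 0"

definition H_mat :: "'k::field ^ 2 ^ 2 \<Rightarrow> 'k ^ 2 ^ 2 \<Rightarrow> 'k ^ g2_basis ^ g2_basis" where
  "H_mat A B = (\<chi> x y. block_entry A B (block_of x) (block_of y))"

lemma sum_basis: "(\<Sum>x\<in>UNIV. f x) = f Ha + f Hb +
    (\<Sum>p\<leftarrow>[R10, R01, R11, R21, R31, R32]. f (E (Pos p)) + f (E (Neg p)))"
  for f :: "g2_basis \<Rightarrow> 'a::comm_monoid_add"
  by (simp add: UNIV_g2_basis UNIV_g2_root UNIV_g2_pos image_Un add_ac)

lemma sum_blocks: "(\<Sum>x\<in>UNIV. f (block_of x)) = f HA + f HB + (\<Sum>i\<in>UNIV. f (First i)) +
    (\<Sum>i\<in>UNIV. f (Second i)) + (\<Sum>i\<in>UNIV. \<Sum>j\<in>UNIV. \<Sum>k\<in>UNIV. f (Tensor i j k))"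
  for f :: "block \<Rightarrow> 'a::comm_monoid_add"
  by (simp add: sum_basis sum_2 add_ac)

lemma matrix_mult_2: "((A :: 'k::field ^ 2 ^ 2) ** B) $ i $ j = A $ i $ 1 * B $ 1 $ j + A $ i $ 2 * B $ 2 $ j"
  by (simp add: matrix_matrix_mult_def sum_2)

lemma det_2_char_2:
  assumes "(2 :: 'k::field) = 0" "det (A :: 'k ^ 2 ^ 2) = 1"
  shows "A $ 1 $ 1 * A $ 2 $ 2 + A $ 1 $ 2 * A $ 2 $ 1 = 1"
  using assms by (simp add: det_2 char_2_arith(3))

text \<open>For a matrix \<open>((p, r), (q, s))\<close> of determinant 1 in characteristic two, the product of the two
  coordinate forms is twisted by the product \<open>x y\<close>.  This is the cocycle condition for the entries in
  the row of \<open>h\<^sub>a\<close> and in the column of \<open>h\<^sub>b\<close>.\<close>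

lemma polarized_square:
  fixes x y p q r s :: "'k::field"
  assumes "p * s + q * r = 1"
  shows "(x * p + y * q) * (x * r + y * s) = x\<^sup>2 * (p * r) + y\<^sup>2 * (q * s) + x * y"
proof -
  have "(x * p + y * q) * (x * r + y * s) =
      x\<^sup>2 * (p * r) + y\<^sup>2 * (q * s) + x * y * (p * s + q * r)"
    by (simp add: algebra_simps power2_eq_square)
  with assms show ?thesis by simp
qed

text \<open>The same for the entry that links \<open>h\<^sub>b\<close> to \<open>h\<^sub>a\<close>: the two mixed products contribute
  \<open>q r + b c\<close>, and the products of four factors cancel in pairs.\<close>

lemma off_diagonal_product:
  fixes a b c d p q r s :: "'k::field"
  assumes "(2 :: 'k) = 0" "a * d + b * c = 1" "p * s + q * r = 1"
  shows "(a * q + b * s) * (c * p + d * r) = a * c * (p * q) + b * d * (r * s) + (q * r + b * c)"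
proof -
  have "a * d = 1 + b * c" "p * s = 1 + q * r"
    using assms(2,3) char_2_arith[OF assms(1)] by (metis add_diff_cancel_right')+
  then have "q * r * (a * d) + b * c * (p * s) = (q * r + b * c) + 2 * (b * c * (q * r))"
    by (simp add: algebra_simps)
  moreover have "(a * q + b * s) * (c * p + d * r) =
      a * c * (p * q) + b * d * (r * s) + (q * r * (a * d) + b * c * (p * s))"
    by (simp add: algebra_simps)
  ultimately show ?thesis
    by (simp add: assms(1))
qed

lemma square_add:
  assumes "(2 :: 'k::field) = 0"
  shows "(x + y)\<^sup>2 = x\<^sup>2 + (y :: 'k)\<^sup>2"
  by (simp add: power2_sum assms)

text \<open>On the three diagonal blocks multiplicativity is that of the natural modules, their Frobenius
  twists and a tensor product.  The determinants enter only through the entries of \<open>h\<^sub>a\<close> and \<open>h\<^sub>b\<close>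
  that glue the 6-dimensional piece together.\<close>

lemma H_mat_mult:
  assumes "(2 :: 'k::field) = 0" "det A = 1" "det B = 1" "det A' = 1" "det B' = 1"
  shows "H_mat A B ** H_mat A' B' = H_mat (A ** A') (B ** (B' :: 'k ^ 2 ^ 2))"
proof -
  note dets = det_2_char_2[OF assms(1,2)] det_2_char_2[OF assms(1,3)]
    det_2_char_2[OF assms(1,4)] det_2_char_2[OF assms(1,5)]
  define S where "S u v = (\<Sum>z\<in>UNIV. block_entry A B u (block_of z) * block_entry A' B' (block_of z) v)"
    for u v
  note S = S_def[unfolded sum_blocks[of "\<lambda>z. block_entry A B u z * block_entry A' B' z v" for u v]]
  let ?T = "block_entry (A ** A') (B ** B')"
  have toral: "S HA HB = ?T HA HB"
    using off_diagonal_product[OF assms(1) dets(1,3)] off_diagonal_product[OF assms(1) dets(2,4)]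
    by (simp add: S sum_2 matrix_mult_2 mult_ac add_ac)
  have rows: "S HA (First j) = ?T HA (First j)" "S HA (Second j) = ?T HA (Second j)" for j
    using polarized_square[OF dets(1), of "A' $ 1 $ j" "A' $ 2 $ j"]
      polarized_square[OF dets(2), of "B' $ 1 $ j" "B' $ 2 $ j"]
    by (simp_all add: S sum_2 matrix_mult_2 mult_ac add_ac)
  have columns: "S (First i) HB = ?T (First i) HB" "S (Second i) HB = ?T (Second i) HB" for i
    using polarized_square[of "A' $ 1 $ 1" "A' $ 2 $ 2" "A' $ 2 $ 1" "A' $ 1 $ 2" "A $ i $ 1" "A $ i $ 2"]
      polarized_square[of "B' $ 1 $ 1" "B' $ 2 $ 2" "B' $ 2 $ 1" "B' $ 1 $ 2" "B $ i $ 1" "B $ i $ 2"]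
      dets(3,4)
    by (simp_all add: S sum_2 matrix_mult_2 mult_ac add_ac)
  have tensor: "S (Tensor i j k) (Tensor i' j' k') = ?T (Tensor i j k) (Tensor i' j' k')"
    for i j k i' j' k'
    by (simp add: S sum_2 matrix_mult_2 square_add[OF assms(1)] power_mult_distrib
        distrib_left distrib_right mult_ac)
  have "S u v = ?T u v" for u v
    by (cases u; cases v; (simp only: toral rows columns tensor)?)
      (simp_all add: S sum_2 matrix_mult_2 square_add[OF assms(1)] power_mult_distrib)
  moreover have "(H_mat A B ** H_mat A' B') $ x $ y = S (block_of x) (block_of y)" for x y
    by (simp add: matrix_matrix_mult_def H_mat_def S_def)
  ultimately show ?thesis
    by (simp add: vec_eq_iff) (simp add: H_mat_def)
qed

lemma H_mat_eq_one:
  assumes "(2 :: 'k::field) = 0" "H_mat A B = (mat 1 :: 'k ^ g2_basis ^ g2_basis)"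
  shows "A = mat 1" "B = mat 1"
proof -
  have e: "block_entry A B (block_of x) (block_of y) = (if x = y then 1 else 0)" for x y
    using arg_cong[OF assms(2), of "\<lambda>M. M $ x $ y"] by (simp add: H_mat_def mat_def)
  note sq = square_eq_one[OF assms(1)]
  show "A = mat 1" "B = mat 1"
    using e[of "E (Pos R32)" "E (Pos R32)"] e[of "E (Neg R32)" "E (Neg R32)"]
      e[of "E (Pos R32)" "E (Neg R32)"] e[of "E (Neg R32)" "E (Pos R32)"]
      e[of "E (Pos R10)" "E (Pos R10)"] e[of "E (Neg R10)" "E (Neg R10)"]
      e[of "E (Pos R10)" "E (Neg R10)"] e[of "E (Neg R10)" "E (Pos R10)"]
    by (simp_all add: vec_eq_iff mat_def forall_2 sq)
qed

lemma H_mat_one: "H_mat (mat 1) (mat 1) = (mat 1 :: 'k::field ^ g2_basis ^ g2_basis)"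
proof -
  have e: "block_entry (mat 1) (mat 1 :: 'k ^ 2 ^ 2) u v = (if u = v then 1 else 0)" for u v
    by (cases u; cases v; simp add: mat_def)
  have "block_of x = block_of y \<longleftrightarrow> x = y" for x y
    by (cases x rule: block_of.cases; cases y rule: block_of.cases; simp)
  then show ?thesis
    by (simp add: vec_eq_iff H_mat_def e) (simp add: mat_def)
qed

definition upper :: "'k::field \<Rightarrow> 'k ^ 2 ^ 2" where
  "upper t = vector [vector [1, t], vector [0, 1]]"

definition lower :: "'k::field \<Rightarrow> 'k ^ 2 ^ 2" where
  "lower t = vector [vector [1, 0], vector [t, 1]]"

text \<open>The terms other than the diagonal 1 in the columns of the generators of \<open>H\<close>, in the order
  \<open>h\<^sub>a\<close>, \<open>h\<^sub>b\<close>, positive roots, negative roots.\<close>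

lemma H_root_columns:
  "map (root_columns (Pos R32)) all_basis = map (\<lambda>(j, l). (0, j) # l) (zip all_basis
    [[], [(1, E (Pos R32))], [], [], [], [], [], [], [], [(1, E (Pos R31))], [(1, E (Pos R21))],
     [(1, E (Pos R11))], [(1, E (Pos R01))], [(1, Ha), (2, E (Pos R32))]])"
  "map (root_columns (Neg R32)) all_basis = map (\<lambda>(j, l). (0, j) # l) (zip all_basis
    [[], [(1, E (Neg R32))], [], [(1, E (Neg R31))], [(1, E (Neg R21))], [(1, E (Neg R11))],
     [(1, E (Neg R01))], [(1, Ha), (2, E (Neg R32))], [], [], [], [], [], []])"
  "map (root_columns (Pos R10)) all_basis = map (\<lambda>(j, l). (0, j) # l) (zip all_basis
    [[], [(1, E (Pos R10))], [], [(1, E (Pos R11)), (2, E (Pos R21)), (3, E (Pos R31))],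
     [(2, E (Pos R31))], [(1, E (Pos R31))], [], [], [(1, Ha), (2, E (Pos R10))], [],
     [(1, E (Neg R01))], [(2, E (Neg R01))],
     [(1, E (Neg R21)), (2, E (Neg R11)), (3, E (Neg R01))], []])"
  "map (root_columns (Neg R10)) all_basis = map (\<lambda>(j, l). (0, j) # l) (zip all_basis
    [[], [(1, E (Neg R10))], [(1, Ha), (2, E (Neg R10))], [], [(1, E (Pos R01))],
     [(2, E (Pos R01))], [(1, E (Pos R21)), (2, E (Pos R11)), (3, E (Pos R01))], [], [],
     [(1, E (Neg R11)), (2, E (Neg R21)), (3, E (Neg R31))], [(2, E (Neg R31))],
     [(1, E (Neg R31))], [], []])"
  by code_simp+

lemma H_root_elts:
  assumes "(2 :: 'k::field) = 0" "chevalley_constants N"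
  shows "root_elt N (Pos R32) t = H_mat (upper t) (mat 1 :: 'k ^ 2 ^ 2)"
    and "root_elt N (Neg R32) t = H_mat (lower t) (mat 1 :: 'k ^ 2 ^ 2)"
    and "root_elt N (Pos R10) t = H_mat (mat 1 :: 'k ^ 2 ^ 2) (upper t)"
    and "root_elt N (Neg R10) t = H_mat (mat 1 :: 'k ^ 2 ^ 2) (lower t)"
proof -
  note cols = H_root_columns[unfolded all_basis_def all_roots_def Let_def, simplified]
  have columns: "root_elt N r t = M"
    if "\<And>i j. entry_at (root_columns r j) t i = M $ i $ j" for r and M :: "'k ^ g2_basis ^ g2_basis"
    using that by (simp add: root_elt_columns[OF assms] vec_eq_iff column_matrix_nth)
  show "root_elt N (Pos R32) t = H_mat (upper t) (mat 1 :: 'k ^ 2 ^ 2)"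
  proof (rule columns)
    fix i j show "entry_at (root_columns (Pos R32) j) t i = H_mat (upper t) (mat 1) $ i $ j"
      by (cases j rule: block_of.cases; cases i rule: block_of.cases;
         simp add: entry_at_def cols H_mat_def upper_def mat_def vector_2 power2_eq_square)
  qed
  show "root_elt N (Neg R32) t = H_mat (lower t) (mat 1 :: 'k ^ 2 ^ 2)"
  proof (rule columns)
    fix i j show "entry_at (root_columns (Neg R32) j) t i = H_mat (lower t) (mat 1) $ i $ j"
      by (cases j rule: block_of.cases; cases i rule: block_of.cases;
         simp add: entry_at_def cols H_mat_def lower_def mat_def vector_2 power2_eq_square)
  qed
  show "root_elt N (Pos R10) t = H_mat (mat 1 :: 'k ^ 2 ^ 2) (upper t)"
  proof (rule columns)
    fix i j show "entry_at (root_columns (Pos R10) j) t i = H_mat (mat 1) (upper t) $ i $ j"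
      by (cases j rule: block_of.cases; cases i rule: block_of.cases;
         simp add: entry_at_def cols H_mat_def upper_def mat_def vector_2 power2_eq_square power3_eq_cube)
  qed
  show "root_elt N (Neg R10) t = H_mat (mat 1 :: 'k ^ 2 ^ 2) (lower t)"
  proof (rule columns)
    fix i j show "entry_at (root_columns (Neg R10) j) t i = H_mat (mat 1) (lower t) $ i $ j"
      by (cases j rule: block_of.cases; cases i rule: block_of.cases;
         simp add: entry_at_def cols H_mat_def lower_def mat_def vector_2 power2_eq_square power3_eq_cube)
  qed
qed

section \<open>The trivial intersection\<close>

text \<open>Seven entries of \<open>h g = g h'\<close> suffice.  The element \<open>g\<close> moves \<open>e\<^sub>a\<close> to
  \<open>e\<^sub>a + e\<^bsub>a+b\<^esub> + e\<^bsub>3a+2b\<^esub>\<close>, while \<open>g h' e\<^sub>a\<close> has no component at \<open>-(3a+2b)\<close>, \<open>-a\<close> and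
  \<open>3a+b\<close>; reading off these components of \<open>h g e\<^sub>a\<close> makes \<open>A\<close> and \<open>B\<close> upper triangular and
  then \<open>B\<close> diagonal.  The column at \<open>-(3a+2b)\<close> makes \<open>A\<close> diagonal, since the square of its corner
  is a component of \<open>g h'\<close> that the row of \<open>h\<^sub>b\<close> shows to be 0.  Finally \<open>h'\<close> fixes \<open>h\<^sub>a\<close>, so \<open>h\<close> fixes
  \<open>g h\<^sub>a\<close>, whose components at \<open>a\<close> and \<open>3a+2b\<close> make the diagonals trivial.\<close>

lemma intertwiner_trivial:
  assumes "(2 :: 'k::field) = 0" "chevalley_constants N"
    and det: "det A = 1" "det B = 1" "det A' = 1" "det B' = 1"
    and g: "g = root_elt N (Pos R01) 1 ** root_elt N (Pos R11) 1 ** root_elt N (Neg R01) 1"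
    and eq: "H_mat A B ** g = g ** H_mat A' (B' :: 'k ^ 2 ^ 2)"
  shows "A = mat 1" "B = mat 1"
proof -
  have entry: "(\<Sum>z\<in>UNIV. H_mat A B $ x $ z * g $ z $ y) = (\<Sum>z\<in>UNIV. g $ x $ z * H_mat A' B' $ z $ y)" for x y
    using arg_cong[OF eq, of "\<lambda>M. M $ x $ y"] by (simp add: matrix_matrix_mult_def)
  have gs: "g $ i $ j = of_bool (i \<in> set l)" if "(j, l) \<in> set g_columns" for i j l
    unfolding g by (rule g_entry[OF assms(1,2) that])
  then have "\<forall>(j, l)\<in>set g_columns. \<forall>i. g $ i $ j = of_bool (i \<in> set l)"
    by blast
  note g_cols = this[unfolded g_columns_def, simplified]
  \<comment> \<open>The equations below are listed in the order of these entries.\<close>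
  note ev = entry[of "E (Neg R32)" "E (Pos R10)"] entry[of "E (Neg R10)" "E (Pos R10)"]
    entry[of "E (Pos R31)" "E (Pos R10)"] entry[of Hb "E (Neg R32)"]
    entry[of "E (Pos R32)" "E (Neg R32)"] entry[of "E (Pos R10)" Ha] entry[of "E (Pos R32)" Ha]
  have ev': "A $ 2 $ 1 = 0" "B $ 2 $ 1 = 0" "A $ 1 $ 1 * B $ 1 $ 1 * (B $ 1 $ 2)\<^sup>2 = 0"
    "A' $ 1 $ 2 * A' $ 2 $ 2 = 0" "(A $ 1 $ 2)\<^sup>2 = A' $ 1 $ 2 * A' $ 2 $ 2"
    "B $ 1 $ 1 * B $ 1 $ 2 + (B $ 1 $ 1)\<^sup>2 = 1" "A $ 1 $ 1 * A $ 1 $ 2 + (A $ 1 $ 1)\<^sup>2 = 1"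
    using ev by (simp_all add: sum_basis H_mat_def g_cols)
  note sq = square_eq_one[OF assms(1)]
  have dets: "A $ 1 $ 1 * A $ 2 $ 2 = 1" "B $ 1 $ 1 * B $ 2 $ 2 = 1"
    using det(1,2) ev'(1,2) by (simp_all add: det_2)
  have "A $ 1 $ 2 = 0" "B $ 1 $ 2 = 0"
    using ev'(3,4,5) dets by auto
  moreover from this have "A $ 1 $ 1 = 1" "B $ 1 $ 1 = 1"
    using ev'(6,7) by (simp_all add: sq)
  ultimately show "A = mat 1" "B = mat 1"
    using dets ev'(1,2) by (simp_all add: vec_eq_iff mat_def forall_2)
qed

section \<open>Linear groups\<close>

lemma GL_simps [simp]:
  "carrier GL = {A. invertible A}" "mult GL = (**)" "one GL = mat 1"
  by (simp_all add: GL_def)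

lemma SL_simps [simp]:
  "carrier SL = {A. det A = 1}" "mult SL = (**)" "one SL = mat 1"
  by (simp_all add: SL_def GL_def)

lemma group_GL: "group (GL :: ('k::field ^ 'n ^ 'n) monoid)"
proof (rule groupI)
  fix A :: "'k ^ 'n ^ 'n" assume "A \<in> carrier GL"
  then obtain B where "A ** B = mat 1" "B ** A = mat 1"
    by (auto simp: invertible_def)
  then show "\<exists>B\<in>carrier GL. B \<otimes>\<^bsub>GL\<^esub> A = \<one>\<^bsub>GL\<^esub>"
    by (auto simp: invertible_def)
qed (auto simp: invertible_mult matrix_mul_assoc, auto simp: invertible_def intro: exI[of _ "mat 1"])

lemma group_SL: "group (SL :: ('k::field ^ 'n ^ 'n) monoid)"
proof (rule groupI)
  fix A :: "'k ^ 'n ^ 'n" assume A: "A \<in> carrier SL"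
  then have "invertible A" by (simp add: invertible_det_nz)
  then obtain B where "B ** A = mat 1"
    by (auto simp: invertible_def)
  moreover from this have "det B = 1"
    using A det_mul[of B A] by simp
  ultimately show "\<exists>B\<in>carrier SL. B \<otimes>\<^bsub>SL\<^esub> A = \<one>\<^bsub>SL\<^esub>" by auto
qed (auto simp: det_mul matrix_mul_assoc)

lemma det_upper_lower: "det (upper t) = 1" "det (lower t) = 1"
  by (simp_all add: det_2 upper_def lower_def)

text \<open>A matrix with a nonzero lower left corner \<open>c\<close> is a product \<open>upper x ** lower c ** upper y\<close>; any
  other one acquires such a corner after multiplication by \<open>lower 1\<close>.\<close>

lemma SL2_generated: "generate SL (range upper \<union> range lower) = carrier (SL :: ('k::field ^ 2 ^ 2) monoid)"
proof
  interpret SL: group "SL :: ('k ^ 2 ^ 2) monoid" by (rule group_SL)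
  let ?P = "generate SL (range upper \<union> range lower) :: ('k ^ 2 ^ 2) set"
  show "?P \<subseteq> carrier SL"
    by (rule SL.generate_incl) (auto simp: det_upper_lower)
  have gen: "upper t \<in> ?P" "lower t \<in> ?P" for t
    by (auto intro: generate.incl)
  have mult: "A ** B \<in> ?P" if "A \<in> ?P" "B \<in> ?P" for A B
    using generate.eng[OF that] by simp
  have big: "A \<in> ?P" if "det A = 1" "A $ 2 $ 1 \<noteq> 0" for A :: "'k ^ 2 ^ 2"
  proof -
    let ?c = "A $ 2 $ 1"
    have "A = upper ((A $ 1 $ 1 - 1) / ?c) ** lower ?c ** upper ((A $ 2 $ 2 - 1) / ?c)"
      using that by (simp add: vec_eq_iff forall_2 matrix_mult_2 upper_def lower_def det_2 field_simps)
    then show ?thesis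
      using gen mult by metis
  qed
  show "carrier SL \<subseteq> ?P"
  proof
    fix A :: "'k ^ 2 ^ 2" assume "A \<in> carrier SL"
    then have det: "det A = 1" by simp
    show "A \<in> ?P"
    proof (cases "A $ 2 $ 1 = 0")
      case True
      then have "A $ 1 $ 1 \<noteq> 0" using det by (auto simp: det_2)
      then have "(lower 1 ** A) $ 2 $ 1 \<noteq> 0"
        using True by (simp add: matrix_mult_2 lower_def)
      then have "lower 1 ** A \<in> ?P"
        using det by (intro big) (simp_all add: det_mul det_upper_lower)
      moreover have "lower (- 1) ** (lower 1 ** A) = A"
        by (simp add: vec_eq_iff forall_2 matrix_mult_2 lower_def)
      ultimately show ?thesis
        using gen mult by metis
    qed (use det big in blast)
  qed
qed

lemma SL_iso_PSL:
  assumes "(2 :: 'k::field) = 0"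
  shows "(SL :: ('k ^ 2 ^ 2) monoid) \<cong> (PSL :: ('k ^ 2 ^ 2) set monoid)"
proof -
  interpret SL: group "SL :: ('k ^ 2 ^ 2) monoid" by (rule group_SL)
  have "c = 1" if "det (mat c :: 'k ^ 2 ^ 2) = 1" for c
  proof -
    have "c\<^sup>2 = 1" using that by (simp add: det_2 mat_def power2_eq_square)
    then show ?thesis
      by (simp add: square_eq_one[OF assms])
  qed
  then have "{A \<in> carrier SL. \<exists>c. A = mat c} = {\<one>\<^bsub>SL\<^esub> :: 'k ^ 2 ^ 2}"
    by auto
  then have eq: "PSL = (SL :: ('k ^ 2 ^ 2) monoid) Mod {\<one>\<^bsub>SL\<^esub>}"
    unfolding PSL_def by (rule arg_cong)
  have "group (PSL :: ('k ^ 2 ^ 2) set monoid)"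
    unfolding eq by (rule normal.factorgroup_is_group[OF SL.one_is_normal])
  moreover have "(PSL :: ('k ^ 2 ^ 2) set monoid) \<cong> (SL :: ('k ^ 2 ^ 2) monoid)"
    unfolding eq by (rule is_isoI[OF SL.trivial_factor_iso])
  ultimately show ?thesis
    by (rule group.iso_sym)
qed

section \<open>Base size two\<close>

text \<open>One conjugate of \<open>H\<close> is not enough, as it is nontrivial like \<open>H\<close>; and the empty set gives
  all of \<open>G\<close>.\<close>

lemma base_size_eq_2:
  assumes "group G" "subgroup H G" "g \<in> carrier G" "H \<noteq> {\<one>\<^bsub>G\<^esub>}"
    and "H \<inter> conjugate G H g = {\<one>\<^bsub>G\<^esub>}"
  shows "base_size G H = 2"
proof -
  interpret G: group G by fact
  interpret H: subgroup H G by fact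
  have one: "\<one>\<^bsub>G\<^esub> \<in> conjugate G H s" if "s \<in> carrier G" for s
    using that unfolding conjugate_def by (intro image_eqI[of _ _ "\<one>\<^bsub>G\<^esub>"]) auto
  have conj_one: "conjugate G H \<one>\<^bsub>G\<^esub> = H"
    using H.subset by (auto simp: conjugate_def image_iff subset_iff)
  have core: "conj_inter G H (carrier G) = {\<one>\<^bsub>G\<^esub>}"
    using assms(3,5) conj_one one unfolding conj_inter_def by blast
  have nontrivial: "conjugate G H s \<noteq> {\<one>\<^bsub>G\<^esub>}" if s: "s \<in> carrier G" for s
  proof
    assume *: "conjugate G H s = {\<one>\<^bsub>G\<^esub>}"
    have "h = \<one>\<^bsub>G\<^esub>" if h: "h \<in> H" for h
    proof -
      have "inv\<^bsub>G\<^esub> s \<otimes>\<^bsub>G\<^esub> h \<otimes>\<^bsub>G\<^esub> s = \<one>\<^bsub>G\<^esub>"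
        using * h unfolding conjugate_def by blast
      then have "h \<otimes>\<^bsub>G\<^esub> s = s"
        using s H.mem_carrier[OF h]
        by (metis G.inv_closed G.inv_solve_left' G.m_assoc G.m_closed G.one_closed G.r_one)
      then show ?thesis
        using s H.mem_carrier[OF h] by simp
    qed
    with assms(4) H.one_closed show False by blast
  qed
  have sub: "conjugate G H s \<subseteq> carrier G" if "s \<in> carrier G" for s
    using that H.subset by (auto simp: conjugate_def)
  show ?thesis
    unfolding base_size_def
  proof (rule Least_equality)
    have "g \<noteq> \<one>\<^bsub>G\<^esub>"
      using assms(4,5) conj_one by auto
    moreover have "conj_inter G H {\<one>\<^bsub>G\<^esub>, g} = {\<one>\<^bsub>G\<^esub>}"
      using assms(5) conj_one H.subset by (auto simp: conj_inter_def)
    ultimately show "\<exists>S\<subseteq>carrier G. finite S \<and> card S = 2 \<and> conj_inter G H S = conj_inter G H (carrier G)"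
      using assms(3) by (intro exI[of _ "{\<one>\<^bsub>G\<^esub>, g}"]) (auto simp: core)
  next
    fix n assume "\<exists>S\<subseteq>carrier G. finite S \<and> card S = n \<and> conj_inter G H S = conj_inter G H (carrier G)"
    then obtain S where S: "S \<subseteq> carrier G" "finite S" "card S = n" "conj_inter G H S = {\<one>\<^bsub>G\<^esub>}"
      by (auto simp: core)
    show "2 \<le> n"
    proof (rule ccontr)
      assume "\<not> 2 \<le> n"
      then consider "card S = 0" | "card S = 1" using S(3) by linarith
      then show False
      proof cases
        case 1
        with S have "carrier G = {\<one>\<^bsub>G\<^esub>}" by (simp add: conj_inter_def)
        with assms(4) H.subset H.one_closed show False by blast
      next
        case 2
        then obtain s where s: "S = {s}" by (auto simp: card_1_singleton_iff)
        with S sub[of s] have "conjugate G H s = {\<one>\<^bsub>G\<^esub>}"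
          by (auto simp: conj_inter_def Int_absorb1)
        with nontrivial S s show False by auto
      qed
    qed
  qed
qed

section \<open>The subgroup \<open>H\<close> and the theorem\<close>

definition H_group :: "('k::field ^ g2_basis ^ g2_basis) set" where
  "H_group = {H_mat A B |A B. det A = 1 \<and> det B = 1}"

lemma H_groupI: "det A = 1 \<Longrightarrow> det B = 1 \<Longrightarrow> H_mat A B \<in> H_group"
  unfolding H_group_def by blast

lemma H_mat_iso:
  assumes "(2 :: 'k::field) = 0"
  shows "(\<lambda>(A, B). H_mat A B) \<in> iso (SL \<times>\<times> SL) (GL\<lparr>carrier := H_group :: ('k ^ g2_basis ^ g2_basis) set\<rparr>)"
proof -
  interpret SL: group "SL :: ('k ^ 2 ^ 2) monoid" by (rule group_SL)
  have "inj_on (\<lambda>(A, B). H_mat A B) (carrier (SL \<times>\<times> (SL :: ('k ^ 2 ^ 2) monoid)))"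
  proof (rule inj_onI, clarsimp)
    fix A B A' B' :: "'k ^ 2 ^ 2"
    assume det: "det A = 1" "det B = 1" "det A' = 1" "det B' = 1" and eq: "H_mat A B = H_mat A' B'"
    obtain C where C: "det C = 1" "C ** A' = mat 1" "A' ** C = mat 1"
      using SL.l_inv[of A'] SL.r_inv[of A'] SL.inv_closed[of A'] det by auto
    obtain D where D: "det D = 1" "D ** B' = mat 1" "B' ** D = mat 1"
      using SL.l_inv[of B'] SL.r_inv[of B'] SL.inv_closed[of B'] det by auto
    have "H_mat (A ** C) (B ** D) = (mat 1 :: 'k ^ g2_basis ^ g2_basis)"
      using H_mat_mult[OF assms det(1,2) C(1) D(1)] H_mat_mult[OF assms det(3,4) C(1) D(1)] eq C D
      by (simp add: H_mat_one)
    then have "A ** C = mat 1" "B ** D = mat 1"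
      using H_mat_eq_one[OF assms] by blast+
    then show "A = A' \<and> B = B'"
      by (metis C(2) D(2) matrix_mul_assoc matrix_mul_lid matrix_mul_rid)
  qed
  moreover have "(\<lambda>(A, B). H_mat A B) ` carrier (SL \<times>\<times> (SL :: ('k ^ 2 ^ 2) monoid)) = H_group"
    by (force simp: H_group_def)
  moreover have "(\<lambda>(A, B). H_mat A B) \<in> hom (SL \<times>\<times> (SL :: ('k ^ 2 ^ 2) monoid)) (GL\<lparr>carrier := H_group\<rparr>)"
    by (rule homI) (auto simp: H_group_def H_mat_mult[OF assms])
  ultimately show ?thesis
    by (simp add: iso_def bij_betw_def)
qed

lemma subgroup_H_group:
  assumes "(2 :: 'k::field) = 0"
  shows "subgroup (H_group :: ('k ^ g2_basis ^ g2_basis) set) GL"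
proof -
  interpret SL: group "SL :: ('k ^ 2 ^ 2) monoid" by (rule group_SL)
  interpret GL: group "GL :: ('k ^ g2_basis ^ g2_basis) monoid" by (rule group_GL)
  have inverse: "\<exists>y\<in>H_group. y ** x = mat 1 \<and> x ** y = mat 1"
    if x: "x \<in> H_group" for x :: "'k ^ g2_basis ^ g2_basis"
  proof -
    obtain A B where AB: "x = H_mat A B" "det A = 1" "det B = 1"
      using x by (auto simp: H_group_def)
    obtain C where C: "det C = 1" "C ** A = mat 1" "A ** C = mat 1"
      using SL.l_inv[of A] SL.r_inv[of A] SL.inv_closed[of A] AB by auto
    obtain D where D: "det D = 1" "D ** B = mat 1" "B ** D = mat 1"
      using SL.l_inv[of B] SL.r_inv[of B] SL.inv_closed[of B] AB by auto
    show ?thesis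
      using AB C D by (intro bexI[of _ "H_mat C D"]) (auto simp: H_mat_mult[OF assms] H_mat_one H_group_def)
  qed
  show ?thesis
  proof (rule GL.subgroupI)
    show sub: "H_group \<subseteq> carrier (GL :: ('k ^ g2_basis ^ g2_basis) monoid)"
      using inverse by (fastforce simp: invertible_def)
    show "(H_group :: ('k ^ g2_basis ^ g2_basis) set) \<noteq> {}"
      using H_groupI[OF det_I det_I] by blast
    fix x y :: "'k ^ g2_basis ^ g2_basis" assume x: "x \<in> H_group"
    from inverse[OF x] obtain z where z: "z \<in> H_group" "z ** x = mat 1" by blast
    with sub x have "inv\<^bsub>GL\<^esub> x = z"
      by (intro GL.inv_equality) auto
    with z show "inv\<^bsub>GL\<^esub> x \<in> H_group" by simp
    assume "y \<in> H_group"
    with x show "x \<otimes>\<^bsub>GL\<^esub> y \<in> H_group"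
      by (auto simp: H_group_def H_mat_mult[OF assms] det_mul) (metis det_mul mult_1)
  qed
qed

text \<open>The root subgroups at \<open>\<plusminus>(3a+2b)\<close> and \<open>\<plusminus>a\<close> are the images of the elementary matrices of the
  two factors, and elementary matrices generate \<open>SL\<^sub>2\<close>.\<close>

lemma generate_H_group:
  assumes "(2 :: 'k::field) = 0" "chevalley_constants N"
  shows "generate GL (root_subgroup N (Pos R32) \<union> root_subgroup N (Neg R32) \<union>
     root_subgroup N (Pos R10) \<union> root_subgroup N (Neg R10)) = (H_group :: ('k ^ g2_basis ^ g2_basis) set)"
    (is "generate GL ?X = _")
proof
  interpret SL: group "SL :: ('k ^ 2 ^ 2) monoid" by (rule group_SL)
  interpret GL: group "GL :: ('k ^ g2_basis ^ g2_basis) monoid" by (rule group_GL)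
  note root_elts = H_root_elts[OF assms]
  have X: "?X = (\<lambda>A. H_mat A (mat 1)) ` (range upper \<union> range lower) \<union>
     (\<lambda>B. H_mat (mat 1) B) ` (range upper \<union> range lower)"
    by (auto simp: root_subgroup_def root_elts)
  have sub: "H_group \<subseteq> carrier (GL :: ('k ^ g2_basis ^ g2_basis) monoid)"
    by (rule subgroup.subset[OF subgroup_H_group[OF assms(1)]])
  show "generate GL ?X \<subseteq> H_group"
    unfolding X
    by (rule GL.generate_subgroup_incl[OF _ subgroup_H_group[OF assms(1)]])
      (force simp: H_group_def det_upper_lower)
  have invertible: "invertible (H_mat A B)" if "det A = 1" "det B = 1" for A B :: "'k ^ 2 ^ 2"
    using sub H_groupI[OF that] by auto
  have hom1: "group_hom SL GL (\<lambda>A. H_mat A (mat 1 :: 'k ^ 2 ^ 2))"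
    by unfold_locales (auto simp: hom_def invertible H_mat_mult[OF assms(1)])
  have hom2: "group_hom SL GL (\<lambda>B. H_mat (mat 1 :: 'k ^ 2 ^ 2) B)"
    by unfold_locales (auto simp: hom_def invertible H_mat_mult[OF assms(1)])
  have elementary: "range upper \<union> range lower \<subseteq> carrier (SL :: ('k ^ 2 ^ 2) monoid)"
    by (auto simp: det_upper_lower)
  have "(\<lambda>A. H_mat A (mat 1)) ` carrier SL \<subseteq> generate GL ?X"
    unfolding X SL2_generated[symmetric] group_hom.generate_img[OF hom1 elementary, symmetric]
    by (rule GL.mono_generate) auto
  moreover have "(\<lambda>B. H_mat (mat 1) B) ` carrier SL \<subseteq> generate GL ?X"
    unfolding X SL2_generated[symmetric] group_hom.generate_img[OF hom2 elementary, symmetric]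
    by (rule GL.mono_generate) auto
  ultimately have "H_mat A (mat 1) \<otimes>\<^bsub>GL\<^esub> H_mat (mat 1) B \<in> generate GL ?X"
    if "det A = 1" "det B = 1" for A B :: "'k ^ 2 ^ 2"
    using that by (intro generate.eng) (auto simp: image_subset_iff)
  then show "H_group \<subseteq> generate GL ?X"
    by (auto simp: H_group_def H_mat_mult[OF assms(1)])
qed

lemma two_eq_0:
  assumes "CARD('k::field) = 2 ^ e"
  shows "(2 :: 'k) = 0"
proof -
  have "finite (UNIV :: 'k set)"
    using assms by (metis card.infinite power_not_zero zero_neq_numeral)
  then have "prime CHAR('k)"
    by (intro prime_CHAR_semidom finite_imp_CHAR_pos)
  moreover have "CHAR('k) dvd 2 ^ e"
    using CHAR_dvd_CARD[where 'a = 'k] assms by simp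
  ultimately have "CHAR('k) = 2"
    by (metis prime_dvd_power primes_dvd_imp_eq two_is_prime_nat)
  then show ?thesis
    by (metis of_nat_CHAR of_nat_numeral)
qed

theorem theoremA1:
  fixes e :: nat
    and N :: "g2_root \<Rightarrow> g2_root \<Rightarrow> int"
    and G :: "('k::field ^ g2_basis ^ g2_basis) monoid"
    and H :: "('k ^ g2_basis ^ g2_basis) set"
    and g :: "'k ^ g2_basis ^ g2_basis"
  assumes "e \<ge> 2"
    and "CARD('k) = 2 ^ e"
    and "chevalley_constants N"
    and "G = G2 N"
    and "H = generate G (root_subgroup N (Pos R32) \<union> root_subgroup N (Neg R32) \<union>
                         root_subgroup N (Pos R10) \<union> root_subgroup N (Neg R10))"
    and "g = root_elt N (Pos R01) 1 \<otimes>\<^bsub>G\<^esub> root_elt N (Pos R11) 1 \<otimes>\<^bsub>G\<^esub> root_elt N (Neg R01) 1"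
  shows "G\<lparr>carrier := H\<rparr> \<cong> (L2 :: ('k ^ 2 ^ 2) set monoid) \<times>\<times> (L2 :: ('k ^ 2 ^ 2) set monoid) \<and>
    H \<inter> conjugate G H g = {\<one>\<^bsub>G\<^esub>} \<and>
    base_size G H = 2"
proof -
  note two = two_eq_0[OF assms(2)]
  interpret GL: group "GL :: ('k ^ g2_basis ^ g2_basis) monoid" by (rule group_GL)
  interpret SL: group "SL :: ('k ^ 2 ^ 2) monoid" by (rule group_SL)
  let ?gens = "\<Union>r. root_subgroup N r :: ('k ^ g2_basis ^ g2_basis) set"
  have gens: "?gens \<subseteq> carrier GL"
    by (auto simp: root_subgroup_def root_elt_invertible[OF assms(3)])
  have subG: "subgroup (generate GL ?gens) GL"
    by (rule GL.generate_is_subgroup[OF gens])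
  have G: "G = GL\<lparr>carrier := generate GL ?gens\<rparr>"
    by (simp add: assms(4) G2_def)
  interpret G: group G
    unfolding G by (rule GL.subgroup_imp_group[OF subG])
  have G_simps: "mult G = (**)" "one G = mat 1" "carrier G = generate GL ?gens"
    by (simp_all add: G)
  have root: "root_elt N r t \<in> carrier G" for r t
    unfolding G_simps by (rule generate.incl) (auto simp: root_subgroup_def)
  let ?X = "root_subgroup N (Pos R32) \<union> root_subgroup N (Neg R32) \<union>
    root_subgroup N (Pos R10) \<union> root_subgroup N (Neg R10) :: ('k ^ g2_basis ^ g2_basis) set"
  have X: "?X \<subseteq> carrier G"
    using root by (auto simp: root_subgroup_def)
  have subH: "subgroup H G"
    unfolding assms(5) by (rule G.generate_is_subgroup[OF X])
  have H: "H = H_group"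
    unfolding assms(5) generate_H_group[OF two assms(3), symmetric] G
    by (rule GL.generate_consistent[OF X[unfolded G_simps] subG])
  have g: "g \<in> carrier G"
    unfolding assms(6) by (intro G.m_closed root)
  have one: "\<one>\<^bsub>G\<^esub> \<in> H" by (rule subgroup.one_closed[OF subH])
  have "(SL :: ('k ^ 2 ^ 2) monoid) \<times>\<times> (SL :: ('k ^ 2 ^ 2) monoid) \<cong> G\<lparr>carrier := H\<rparr>"
    using is_isoI[OF H_mat_iso[OF two]] by (simp add: G H)
  then have "G\<lparr>carrier := H\<rparr> \<cong> (SL :: ('k ^ 2 ^ 2) monoid) \<times>\<times> (SL :: ('k ^ 2 ^ 2) monoid)"
    by (rule group.iso_sym[OF DirProd_group[OF group_SL group_SL]])
  also have "(SL :: ('k ^ 2 ^ 2) monoid) \<times>\<times> (SL :: ('k ^ 2 ^ 2) monoid) \<cong>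
      (L2 :: ('k ^ 2 ^ 2) set monoid) \<times>\<times> (L2 :: ('k ^ 2 ^ 2) set monoid)"
    by (intro SL.DirProd_iso_trans SL_iso_PSL[OF two])
  finally have iso: "G\<lparr>carrier := H\<rparr> \<cong> (L2 :: ('k ^ 2 ^ 2) set monoid) \<times>\<times> (L2 :: ('k ^ 2 ^ 2) set monoid)" .
  have trivial: "H \<inter> conjugate G H g = {\<one>\<^bsub>G\<^esub>}"
  proof (intro equalityI subsetI)
    fix x assume "x \<in> H \<inter> conjugate G H g"
    then obtain h where h: "h \<in> H" and x: "x \<in> H" "x = inv\<^bsub>G\<^esub> g \<otimes>\<^bsub>G\<^esub> h \<otimes>\<^bsub>G\<^esub> g"
      by (auto simp: conjugate_def)
    have hG: "h \<in> carrier G"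
      using h subgroup.subset[OF subH] by blast
    then have "g \<otimes>\<^bsub>G\<^esub> x = h \<otimes>\<^bsub>G\<^esub> g"
      using g unfolding x(2) by (metis G.inv_closed G.m_assoc G.m_closed G.l_one G.r_inv)
    then have eq: "h ** g = g ** x" by (simp add: G_simps)
    obtain A B A' B' :: "'k ^ 2 ^ 2" where AB: "h = H_mat A B" "x = H_mat A' B'"
      and det: "det A = 1" "det B = 1" "det A' = 1" "det B' = 1"
      using h x(1) unfolding H H_group_def by blast
    have "A = mat 1" "B = mat 1"
      using intertwiner_trivial[OF two assms(3) det assms(6)[unfolded G_simps] eq[unfolded AB]] .
    then have "h = \<one>\<^bsub>G\<^esub>" by (simp add: AB H_mat_one G_simps)
    with x(2) g show "x \<in> {\<one>\<^bsub>G\<^esub>}" by simp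
  next
    fix x assume "x \<in> {\<one>\<^bsub>G\<^esub>}"
    moreover have "\<one>\<^bsub>G\<^esub> \<in> conjugate G H g"
      unfolding conjugate_def using one g by (intro image_eqI[of _ _ "\<one>\<^bsub>G\<^esub>"]) auto
    ultimately show "x \<in> H \<inter> conjugate G H g"
      using one by simp
  qed
  have "H_mat (upper 1) (mat 1 :: 'k ^ 2 ^ 2) \<in> H"
    unfolding H by (rule H_groupI) (simp_all add: det_upper_lower)
  moreover have "H_mat (upper 1) (mat 1 :: 'k ^ 2 ^ 2) \<noteq> \<one>\<^bsub>G\<^esub>"
  proof
    assume "H_mat (upper 1) (mat 1 :: 'k ^ 2 ^ 2) = \<one>\<^bsub>G\<^esub>"
    then have "(upper 1 :: 'k ^ 2 ^ 2) = mat 1"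
      by (intro H_mat_eq_one(1)[OF two]) (simp add: G_simps)
    from arg_cong[OF this, of "\<lambda>M. M $ 1 $ 2"] show False
      by (simp add: upper_def mat_def)
  qed
  ultimately have "H \<noteq> {\<one>\<^bsub>G\<^esub>}" by blast
  then have "base_size G H = 2"
    by (rule base_size_eq_2[OF G.is_group subH g _ trivial])
  with iso trivial show ?thesis by blast
qed

end
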